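(* Let $\mathcal Z$ be a real separable Hilbert space. For $i=1,2$ let $F_i:\mathcal Z\to\mathcal Z$ be monotone and $L_{F_i}$-Lipschitz continuous and let $g_i\in\Gamma_0(\mathcal Z)$, with $\mathrm{dom}(g_1)\cap\mathrm{dom}(g_2)\neq\emptyset$. Let $\mathcal S_2=\mathrm{zer}(F_2+\partial g_2)$ and assume $\mathcal S_2\ne\emptyset$. Let $\mathcal S_1$ be the solution set of the hierarchical problem (see context) and assume $\mathcal S_1=\mathrm{zer}(F_1+\partial g_1+N_{\mathcal S_2})\neq\emptyset$. Let $(t_k)_{k\ge1}\subset(0,\infty)$ and let $(\sigma_k)_{k\ge1}\subset(0,\infty)$ be decreasing ($\sigma_{k+1}\le\sigma_k$), with $$\lim_{k\to\infty}\sigma_k=0,\quad \lim_{K\to\infty}\sum_{k=1}^K t_k=\infty,\quad \lim_{K\to\infty}\sigma_K\sum_{k=1}^K t_k=\infty,\quad \lim_{K\to\infty}\frac{\sum_{k=1}^K t_k\sigma_k}{\sum_{k=1}^K t_k}=0 ,$$ and assume that for every $p\in\mathrm{Range}(N_{\mathcal S_2})$ $$\sum_{k=1}^\infty t_k\Big[\sup_{z\in\mathcal S_2}\varphi^{(F_2,g_2)}(z,\sigma_kp)-\mathtt s(\sigma_kp\,|\,\mathcal S_2)\Big]<\infty .$$ Assume further that $\mathrm{dom}(g_2)\subseteq\mathrm{dom}(g_1)$. Let $z^1=z^{1/2}\in\mathcal Z$ and let $(z^k)_{k\ge1}$ and $(z^{k+1/2})_{k\ge1}$ be generated by the optimistic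 extragradient method (see context), where $16t_k^2L_k^2\le1$ for all $k\ge1$ with $L_k=L_{F_2}+\sigma_kL_{F_1}$. Then: (i) All weak accumulation points of $(z^{k+1/2})_{k\ge1}$ are contained in $\mathcal S_2$. (ii) If additionally $\mathrm{dom}(g_1)\cap\mathrm{dom}(g_2)$ is closed and for all compact sets $\mathcal A,\mathcal B\subset\mathrm{dom}(g_1)\cap\mathrm{dom}(g_2)$ one has $\sup_{(x,y)\in\mathcal A\times\mathcal B}|g_1(x)-g_1(y)|<\infty$, then the sequence of averages $\bar z^K=\big(\sum_{k=1}^K t_k\big)^{-1}\sum_{k=1}^K t_kz^{k+1/2}$, $K\ge1$, converges weakly to an element of $\mathcal S_1$.
   Context: $\Gamma_0(\mathcal Z)$ is the class of proper convex lower semicontinuous functions $\mathcal Z\to(-\infty,+\infty]$; $\mathrm{dom}(g)=\{z: g(z)<\infty\}$; $\mathrm{zer}(A)=\{z:0\in A(z)\}$; $N_{\mathcal C}(z)=\{p:\langle p,z'-z\rangle\le0\ \forall z'\in\mathcal C\}$ for $z\in\mathcal C$ is the normal cone and $\mathrm{Range}(N_{\mathcal C})=\bigcup_{z\in\mathcal C}N_{\mathcal C}(z)$; $\mathtt s(p|\mathcal C)=\sup_{z\in\mathcal C}\langle p,z\rangle$ is the support function; $\mathrm{prox}_G(u)=\mathrm{argmin}_{z}\{G(z)+\tfrac12\|z-u\|^2\}$. Hierarchical problem: find $z^*\in\mathcal S_2$ such that $\langle F_1(z^* ),z-z^*\rangle+g_1(z)-g_1(z^* )\ge0$ for all $z\in\mathcal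 S_2$, where $\mathcal S_2=\mathrm{zer}(F_2+\partial g_2)$. $\mathcal S_1$ denotes its set of solutions. Function $\varphi$: $\varphi^{(F_2,g_2)}(z,u)=\sup_{y\in\mathrm{dom}(g_2)}\{H^{(F_2,g_2)}(z,y)+\langle y,u\rangle\}$, where $H^{(F,g)}(z,y)=\langle F(y),z-y\rangle+g(z)-g(y)$. Optimistic extragradient method: with $V_k=F_2+\sigma_kF_1$ and $G_k=g_2+\sigma_kg_1$, starting from $z^1=z^{1/2}$, for $k\ge1$: $$z^{k+1/2}=\mathrm{prox}_{t_kG_k}\big(z^k-t_kV_k(z^{k-1/2})\big),\qquad z^{k+1}=\mathrm{prox}_{t_kG_k}\big(z^k-t_kV_k(z^{k+1/2})\big).$$ *)

theory Defs
  imports "HOL-Analysis.Analysis"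
begin

definition eff_dom :: "('a \<Rightarrow> ereal) \<Rightarrow> 'a set" where
  "eff_dom g = {z. g z < \<infinity>}"

text \<open>
  Proper convex lower semicontinuous functions. No \<open>\<infinity> - \<infinity>\<close> arises in the convexity inequality,
  since \<open>-\<infinity>\<close> is excluded; for \<open>u = 0\<close> and \<open>u = 1\<close> the inequality is trivial because
  \<open>0 * \<infinity> = 0\<close> in \<^typ>\<open>ereal\<close>.
\<close>

definition Gamma0 :: "('a::real_normed_vector \<Rightarrow> ereal) set" where
  "Gamma0 = {g.
     (\<forall>x. g x \<noteq> -\<infinity>) \<and> eff_dom g \<noteq> {} \<and>
     (\<forall>x y. \<forall>u\<in>{0..1::real}.
        g ((1 - u) *\<^sub>R x + u *\<^sub>R y) \<le> ereal (1 - u) * g x + ereal u * g y) \<and>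
     (\<forall>x. g x \<le> Liminf (at x) g)}"

definition monotone_operator :: "('a::real_inner \<Rightarrow> 'a) \<Rightarrow> bool" where
  "monotone_operator F \<longleftrightarrow> (\<forall>x y. (F x - F y) \<bullet> (x - y) \<ge> 0)"

definition subdifferential :: "('a::real_inner \<Rightarrow> ereal) \<Rightarrow> 'a \<Rightarrow> 'a set" where
  "subdifferential g z = {p. \<forall>y. g z + ereal (p \<bullet> (y - z)) \<le> g y}"

definition normal_cone :: "'a::real_inner set \<Rightarrow> 'a \<Rightarrow> 'a set" where
  "normal_cone C z = {p. z \<in> C \<and> (\<forall>z'\<in>C. p \<bullet> (z' - z) \<le> 0)}"

definition op_range :: "('b \<Rightarrow> 'a set) \<Rightarrow> 'a set" where
  "op_range A = (\<Union>z. A z)"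

definition zer :: "('a \<Rightarrow> 'a::zero set) \<Rightarrow> 'a set" where
  "zer A = {z. 0 \<in> A z}"

text \<open>Sums of set-valued operators are pointwise Minkowski sums.\<close>

definition op_add :: "('a \<Rightarrow> 'a::plus set) \<Rightarrow> ('a \<Rightarrow> 'a set) \<Rightarrow> 'a \<Rightarrow> 'a set" where
  "op_add A B = (\<lambda>z. {a + b |a b. a \<in> A z \<and> b \<in> B z})"

definition single :: "('a \<Rightarrow> 'a) \<Rightarrow> 'a \<Rightarrow> 'a set" where
  "single F = (\<lambda>z. {F z})"

definition support_fun :: "'a::real_inner set \<Rightarrow> 'a \<Rightarrow> ereal" where
  "support_fun C p = (SUP z\<in>C. ereal (p \<bullet> z))"

text \<open>
  For proper \<open>G\<close> in \<^const>\<open>Gamma0\<close> on a Hilbert space the minimiser exists and is unique, so the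
  choice made by \<^const>\<open>arg_min\<close> is irrelevant.
\<close>

definition prox :: "('a::real_normed_vector \<Rightarrow> ereal) \<Rightarrow> 'a \<Rightarrow> 'a" where
  "prox G u = (ARG_MIN (\<lambda>z. G z + ereal ((norm (z - u))\<^sup>2 / 2)) z. True)"

text \<open>
  The variational inequality of the upper level over the lower-level solution set \<open>S2\<close>. The
  difference \<open>g1 z - g1 zs\<close> is meaningful when \<open>S2\<close> lies in the effective domain of \<open>g1\<close>.
\<close>

definition hierarchical_solutions ::
  "('a::real_inner \<Rightarrow> 'a) \<Rightarrow> ('a \<Rightarrow> ereal) \<Rightarrow> 'a set \<Rightarrow> 'a set" where
  "hierarchical_solutions F1 g1 S2 =
     {zs \<in> S2. \<forall>z\<in>S2. 0 \<le> ereal (F1 zs \<bullet> (z - zs)) + g1 z - g1 zs}"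

text \<open>Used only for \<open>y\<close> in the effective domain of \<open>g\<close>, so that \<open>g y\<close> is finite.\<close>

definition H_fun :: "('a::real_inner \<Rightarrow> 'a) \<Rightarrow> ('a \<Rightarrow> ereal) \<Rightarrow> 'a \<Rightarrow> 'a \<Rightarrow> ereal" where
  "H_fun F g z y = ereal (F y \<bullet> (z - y)) + g z - g y"

definition phi_fun :: "('a::real_inner \<Rightarrow> 'a) \<Rightarrow> ('a \<Rightarrow> ereal) \<Rightarrow> 'a \<Rightarrow> 'a \<Rightarrow> ereal" where
  "phi_fun F g z u = (SUP y\<in>eff_dom g. H_fun F g z y + ereal (y \<bullet> u))"

text \<open>
  Half-integer indices: \<open>w k\<close> stands for \<open>z\<^sup>k\<^sup>+\<^sup>1\<^sup>/\<^sup>2\<close>, so \<open>w 0\<close> is \<open>z\<^sup>1\<^sup>/\<^sup>2\<close> and \<open>w (k - 1)\<close> is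
  \<open>z\<^sup>k\<^sup>-\<^sup>1\<^sup>/\<^sup>2\<close>. The values \<open>z 0\<close>, \<open>t 0\<close> and \<open>\<sigma> 0\<close> are unused.
\<close>

definition optimistic_extragradient ::
  "('a::real_inner \<Rightarrow> 'a) \<Rightarrow> ('a \<Rightarrow> 'a) \<Rightarrow> ('a \<Rightarrow> ereal) \<Rightarrow> ('a \<Rightarrow> ereal) \<Rightarrow>
   (nat \<Rightarrow> real) \<Rightarrow> (nat \<Rightarrow> real) \<Rightarrow> (nat \<Rightarrow> 'a) \<Rightarrow> (nat \<Rightarrow> 'a) \<Rightarrow> bool" where
  "optimistic_extragradient F1 F2 g1 g2 t \<sigma> z w \<longleftrightarrow>
     z 1 = w 0 \<and>
     (\<forall>k\<ge>1.
        let V = (\<lambda>x. F2 x + \<sigma> k *\<^sub>R F1 x);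
            tG = (\<lambda>x. ereal (t k) * (g2 x + ereal (\<sigma> k) * g1 x))
        in w k = prox tG (z k - t k *\<^sub>R V (w (k - 1))) \<and>
           z (k + 1) = prox tG (z k - t k *\<^sub>R V (w k)))"

definition weakly_converges :: "(nat \<Rightarrow> 'a::real_inner) \<Rightarrow> 'a \<Rightarrow> bool" where
  "weakly_converges X x \<longleftrightarrow> (\<forall>y. (\<lambda>n. X n \<bullet> y) \<longlonglongrightarrow> x \<bullet> y)"

definition weak_accumulation_point :: "(nat \<Rightarrow> 'a::real_inner) \<Rightarrow> 'a \<Rightarrow> bool" where
  "weak_accumulation_point X x \<longleftrightarrow>
     (\<exists>r::nat \<Rightarrow> nat. strict_mono r \<and> weakly_converges (X \<circ> r) x)"

end

theory Submission
  imports Defs "HOL-Complex_Analysis.Great_Picard"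
begin

text \<open>
  The proof follows the energy \<open>\<parallel>z k - y\<parallel>\<^sup>2 / 2 + \<parallel>z k - w (k - 1)\<parallel>\<^sup>2 / 8\<close>. In one step it grows by
  at most \<open>t k * (H2 y (w k) + \<sigma> k * H1 y (w k))\<close>, up to the squared step lengths, which are gained
  (\<open>energy_step\<close>); here \<open>Hi\<close> is the gap function of \<open>Fi\<close> and \<open>gi\<close>. At a solution \<open>y\<close> of the hierarchical problem
  the optimality condition gives a normal \<open>p\<close> of \<open>S2\<close> at \<open>y\<close> with \<open>H1 y x \<le> p \<bullet> (x - y)\<close>, and the
  summability hypothesis, applied to \<open>2 p\<close>, bounds the total growth (\<open>quasi_fejer_S1\<close>). Hence the iterates are bounded,
  \<open>z k - w k\<close> tends to \<open>0\<close>, the distance of \<open>z k\<close> to every point of \<open>S1\<close> converges, and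
  \<open>t k * H2 y (w k)\<close> is summable.

  Accumulation points. If \<open>x\<close> were a weak accumulation point outside \<open>S2\<close>, let \<open>v\<close> be the point of \<open>S2\<close> nearest
  to \<open>x\<close>. The summability hypothesis for the normal \<open>x - v\<close> makes \<open>H2 y\<close> uniformly negative, for every
  \<open>y\<close> in \<open>S2\<close>, on the points of the domain in a half-space that is a weak neighbourhood of \<open>x\<close>
  (\<open>gap_uniformly_negative\<close>). Since
  \<open>t k * H2 y (w k)\<close> is summable, the total time \<open>\<Sum>t\<close> spent there is finite. As the step sizes may tend to \<open>0\<close>, a
  contradiction needs a bound on the speed of the iterates: the objective values \<open>g2 + \<sigma> k * g1\<close> at \<open>z k\<close> stay
  bounded (\<open>objective_bounded\<close>), so that \<open>\<parallel>z n - z m\<parallel>\<^sup>2\<close> is at most a constant times the time elapsed from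
  \<open>m\<close> to \<open>n\<close> (\<open>iterates_equicontinuous\<close>), and every visit to the half-space lasts for a fixed time.

  Averages. Summing the energy inequality for a fixed \<open>y\<close> in the domain of \<open>g2\<close> and dividing by \<open>\<Sum>t\<close> shows
  that weak cluster points of the averages satisfy Minty's inequality for the lower level. For \<open>y\<close> in
  \<open>S2\<close> one may first divide by \<open>\<sigma> k\<close>; summation by parts leaves an error of order
  \<open>1 / (\<sigma> K * \<Sum>t)\<close>, so the cluster points satisfy Minty's inequality for the upper level as well
  (\<open>weak_cluster_of_averages_in_S1\<close>). Opial's argument then makes the cluster point unique.

  The Hilbert space facts that this uses, namely existence of proximal points, Riesz representation, weak closedness of closed
  convex sets and weak sequential compactness, all rest on one minimisation result (\<open>prox_exists\<close>).
\<close>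

section \<open>Convex lower semicontinuous functions in real-valued form\<close>

text \<open>
  The pair of \<open>C\<close> and \<open>f\<close> stands for the extended-real function that is \<open>f\<close> on \<open>C\<close> and \<open>\<infinity>\<close> elsewhere. That the
  limit lies in \<open>C\<close> is part of the semicontinuity of that function; \<open>C\<close> itself need not be closed.
\<close>

definition convex_lsc :: "'a::real_normed_vector set \<Rightarrow> ('a \<Rightarrow> real) \<Rightarrow> bool" where
  "convex_lsc C f \<longleftrightarrow> C \<noteq> {} \<and> convex_on C f \<and>
     (\<forall>X x M. (\<forall>n. X n \<in> C \<and> f (X n) \<le> M) \<longrightarrow> X \<longlonglongrightarrow> x \<longrightarrow> x \<in> C \<and> f x \<le> M)"

lemma convex_lsc_nonempty: "convex_lsc C f \<Longrightarrow> C \<noteq> {}"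
  unfolding convex_lsc_def by (elim conjE)

lemma convex_lsc_convex_on: "convex_lsc C f \<Longrightarrow> convex_on C f"
  unfolding convex_lsc_def by (elim conjE)

lemma convex_lsc_convex: "convex_lsc C f \<Longrightarrow> convex C"
  by (rule convex_on_imp_convex[OF convex_lsc_convex_on])

lemma convex_lsc_limit:
  assumes "convex_lsc C f" "eventually (\<lambda>n. X n \<in> C \<and> f (X n) \<le> M) sequentially" "X \<longlonglongrightarrow> x"
  shows "x \<in> C \<and> f x \<le> M"
proof -
  obtain N where N: "\<And>n. n \<ge> N \<Longrightarrow> X n \<in> C \<and> f (X n) \<le> M"
    using assms(2) by (auto simp: eventually_sequentially)
  have "(\<lambda>n. X (n + N)) \<longlonglongrightarrow> x"
    using assms(3) by (rule LIMSEQ_ignore_initial_segment)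
  moreover have "\<forall>n. X (n + N) \<in> C \<and> f (X (n + N)) \<le> M"
    using N by simp
  ultimately show ?thesis
    using assms(1)[unfolded convex_lsc_def, THEN conjunct2, THEN conjunct2, rule_format,
        of "\<lambda>n. X (n + N)" M x] by auto
qed

lemma convex_lsc_eventually_greater:
  assumes f: "convex_lsc C f" and X: "\<And>n. X n \<in> C" "X \<longlonglongrightarrow> x" and "c < f x"
  shows "eventually (\<lambda>n. c < f (X n)) sequentially"
proof (rule ccontr)
  assume "\<not> ?thesis"
  then have "\<exists>\<^sub>F n in sequentially. f (X n) \<le> c"
    by (simp add: frequently_def not_le)
  then have inf: "infinite {n. f (X n) \<le> c}"
    by (simp add: cofinite_eq_sequentially [symmetric] frequently_cofinite)
  define r where "r = enumerate {n. f (X n) \<le> c}"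
  have r: "strict_mono r" "\<And>n. f (X (r n)) \<le> c"
    using strict_mono_enumerate[OF inf] enumerate_in_set[OF inf] by (auto simp: r_def)
  have "f x \<le> c"
    using convex_lsc_limit[OF f, of "X \<circ> r" c x] r X LIMSEQ_subseq_LIMSEQ[OF X(2) r(1)]
    by simp
  with \<open>c < f x\<close> show False by simp
qed

text \<open>
  Near a point of the domain semicontinuity keeps \<open>f\<close> above some constant; convexity along the
  segments through that point spreads this bound to a minorant of linear growth. Such a minorant
  does the work of an affine minorant without an appeal to the Hahn-Banach theorem.
\<close>

lemma convex_lsc_minorant:
  assumes f: "convex_lsc C f"
  obtains a b where "b \<ge> 0" "\<And>y. y \<in> C \<Longrightarrow> a - b * norm y \<le> f y"
proof -
  obtain x0 where x0: "x0 \<in> C"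
    using convex_lsc_nonempty[OF f] by blast
  have "\<exists>r>0. \<forall>y\<in>C. norm (y - x0) \<le> r \<longrightarrow> f x0 - 1 \<le> f y"
  proof (rule ccontr)
    assume no: "\<not> ?thesis"
    have "\<exists>y. y \<in> C \<and> norm (y - x0) \<le> 1 / real (Suc n) \<and> f y < f x0 - 1" for n
    proof -
      have "1 / real (Suc n) > 0" by simp
      with no show ?thesis by (meson not_le)
    qed
    then obtain Y where Y: "\<And>n. Y n \<in> C" "\<And>n. norm (Y n - x0) \<le> 1 / real (Suc n)"
        "\<And>n. f (Y n) < f x0 - 1"
      by metis
    have "(\<lambda>n. Y n - x0) \<longlonglongrightarrow> 0"
      by (rule Lim_null_comparison[OF _ LIMSEQ_Suc[OF lim_1_over_n]]) (use Y(2) in simp)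
    then have "Y \<longlonglongrightarrow> x0" by (simp add: LIM_zero_iff)
    from convex_lsc_limit[OF f _ this, of "f x0 - 1"] Y show False
      by (auto simp: less_imp_le)
  qed
  then obtain r where r: "r > 0" "\<And>y. y \<in> C \<Longrightarrow> norm (y - x0) \<le> r \<Longrightarrow> f x0 - 1 \<le> f y"
    by blast
  have low: "f x0 - 1 - norm (y - x0) / r \<le> f y" if y: "y \<in> C" for y
  proof (cases "norm (y - x0) \<le> r")
    case True
    then show ?thesis using r y by (smt (verit) divide_nonneg_pos norm_ge_zero)
  next
    case False
    define R where "R = norm (y - x0)"
    have R: "R > r" "R > 0" using False r by (auto simp: R_def)
    define u where "u = r / R"
    have u: "0 < u" "u \<le> 1" using R r by (auto simp: u_def)
    let ?q = "(1 - u) *\<^sub>R x0 + u *\<^sub>R y"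
    have q: "?q - x0 = u *\<^sub>R (y - x0)" by (simp add: algebra_simps)
    have "?q \<in> C"
      using convexD_alt[OF convex_lsc_convex[OF f] x0 y] u by simp
    moreover have "norm (?q - x0) \<le> r"
      unfolding q using R r by (simp add: u_def R_def[symmetric])
    ultimately have "f x0 - 1 \<le> f ?q" by (rule r(2))
    also have "\<dots> \<le> (1 - u) * f x0 + u * f y"
      using convex_onD[OF convex_lsc_convex_on[OF f]] u x0 y by simp
    finally have "u * (f x0 - f y) \<le> 1" by (simp add: algebra_simps)
    then have "f x0 - f y \<le> 1 / u" using u by (simp add: field_simps)
    then show ?thesis by (simp add: u_def R_def)
  qed
  show ?thesis
  proof (rule that[of "1 / r" "f x0 - 1 - norm x0 / r"])
    fix y assume "y \<in> C"
    have "norm (y - x0) / r \<le> (norm y + norm x0) / r"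
      using r norm_triangle_ineq4[of y x0] by (simp add: divide_right_mono)
    with low[OF \<open>y \<in> C\<close>] show "f x0 - 1 - norm x0 / r - 1 / r * norm y \<le> f y"
      by (simp add: add_divide_distrib)
  qed (simp add: less_imp_le[OF r(1)])
qed

lemma convex_lsc_bounded_below:
  assumes f: "convex_lsc C f"
  obtains m where "\<And>y. y \<in> C \<Longrightarrow> norm y \<le> B \<Longrightarrow> m \<le> f y"
proof -
  obtain a b where ab: "b \<ge> 0" "\<And>y. y \<in> C \<Longrightarrow> a - b * norm y \<le> f y"
    using convex_lsc_minorant[OF f] by blast
  show ?thesis
  proof (rule that[of "a - b * B"])
    fix y assume "y \<in> C" "norm y \<le> B"
    with ab(2)[of y] mult_left_mono[OF \<open>norm y \<le> B\<close> ab(1)] show "a - b * B \<le> f y" by linarith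
  qed
qed

lemma convex_lsc_scaled:
  assumes f: "convex_lsc C f" and s: "s > 0"
  shows "convex_lsc C (\<lambda>x. s * f x)"
  unfolding convex_lsc_def
proof (intro conjI allI impI)
  show "C \<noteq> {}" by (rule convex_lsc_nonempty[OF f])
  show "convex_on C (\<lambda>x. s * f x)"
    using convex_lsc_convex_on[OF f] s by (intro convex_on_cmul) auto
next
  fix X x M
  assume XM: "\<forall>n. X n \<in> C \<and> s * f (X n) \<le> M" and X: "X \<longlonglongrightarrow> x"
  have "eventually (\<lambda>n. X n \<in> C \<and> f (X n) \<le> M / s) sequentially"
    using XM s by (simp add: pos_le_divide_eq mult.commute)
  from convex_lsc_limit[OF f this X] show "x \<in> C" "s * f x \<le> M"
    using s by (simp_all add: pos_le_divide_eq mult.commute)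
qed

text \<open>
  Each summand is bounded below along the convergent sequence, so a bound on the sum bounds both
  summands and keeps the limit in the domain.
\<close>

lemma convex_lsc_add_scaled:
  assumes f: "convex_lsc C f" and h: "convex_lsc D h" and "C \<subseteq> D" and s: "s > 0"
  shows "convex_lsc C (\<lambda>x. f x + s * h x)"
  unfolding convex_lsc_def
proof (intro conjI allI impI)
  show "C \<noteq> {}" by (rule convex_lsc_nonempty[OF f])
  have "convex_on C h"
    using convex_on_subset[OF convex_lsc_convex_on[OF h] \<open>C \<subseteq> D\<close> convex_lsc_convex[OF f]] .
  then show "convex_on C (\<lambda>x. f x + s * h x)"
    using convex_lsc_convex_on[OF f] s by (intro convex_on_add convex_on_cmul) auto
next
  fix X x M
  assume XM: "\<forall>n. X n \<in> C \<and> f (X n) + s * h (X n) \<le> M" and X: "X \<longlonglongrightarrow> x"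
  obtain B where B: "\<And>n. norm (X n) \<le> B"
    using convergent_imp_Bseq[OF convergentI[OF X]] unfolding Bseq_def by blast
  obtain m where m: "\<And>y. y \<in> D \<Longrightarrow> norm y \<le> B \<Longrightarrow> m \<le> h y"
    using convex_lsc_bounded_below[OF h, of B] by blast
  have "f (X n) \<le> M - s * m" for n
  proof -
    have "s * m \<le> s * h (X n)"
      using m B XM \<open>C \<subseteq> D\<close> s by (intro mult_left_mono) auto
    then show ?thesis using XM by (smt (verit))
  qed
  then have x: "x \<in> C"
    using convex_lsc_limit[OF f _ X, of "M - s * m"] XM by simp
  have "f x + s * h x \<le> M"
  proof (rule field_le_epsilon)
    fix e :: real assume "e > 0"
    define d where "d = e / (1 + s)"
    have d: "d > 0" using s \<open>e > 0\<close> by (simp add: d_def)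
    have "d * (1 + s) = e" using s by (simp add: d_def)
    then have de: "d + s * d = e" by (simp add: algebra_simps)
    have "eventually (\<lambda>n. f x - d < f (X n)) sequentially"
      by (rule convex_lsc_eventually_greater[OF f _ X]) (use XM d in auto)
    moreover have "eventually (\<lambda>n. h x - d < h (X n)) sequentially"
      by (rule convex_lsc_eventually_greater[OF h _ X]) (use XM d \<open>C \<subseteq> D\<close> in auto)
    ultimately have "eventually (\<lambda>n. f x - d < f (X n) \<and> h x - d < h (X n)) sequentially"
      by eventually_elim simp
    then obtain n where n: "f x - d < f (X n)" "h x - d < h (X n)"
      using eventually_happens'[OF sequentially_bot] by blast
    have "s * (h x - d) \<le> s * h (X n)" using n s by simp
    then have "f x + s * h x - (d + s * d) \<le> f (X n) + s * h (X n)"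
      using n by (simp add: algebra_simps)
    then show "f x + s * h x \<le> M + e" using XM de by (smt (verit))
  qed
  with x show "x \<in> C" "f x + s * h x \<le> M" by auto
qed

lemma convex_lsc_of_Gamma0:
  assumes g: "g \<in> Gamma0"
  shows "convex_lsc (eff_dom g) (\<lambda>x. real_of_ereal (g x))"
    and "\<And>x. x \<in> eff_dom g \<Longrightarrow> g x = ereal (real_of_ereal (g x))"
    and "\<And>x. x \<notin> eff_dom g \<Longrightarrow> g x = \<infinity>"
proof -
  have fin: "g x = ereal (real_of_ereal (g x))" if "x \<in> eff_dom g" for x
    using that g by (cases "g x") (auto simp: eff_dom_def Gamma0_def)
  then show "\<And>x. x \<in> eff_dom g \<Longrightarrow> g x = ereal (real_of_ereal (g x))" .
  show "\<And>x. x \<notin> eff_dom g \<Longrightarrow> g x = \<infinity>" by (simp add: eff_dom_def)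
  have conv: "g ((1 - u) *\<^sub>R x + u *\<^sub>R y) \<le> ereal (1 - u) * g x + ereal u * g y"
    if "0 \<le> u" "u \<le> 1" for x y u
    using g that unfolding Gamma0_def by simp
  have conv_dom: "(1 - u) *\<^sub>R x + u *\<^sub>R y \<in> eff_dom g \<and>
      real_of_ereal (g ((1 - u) *\<^sub>R x + u *\<^sub>R y))
        \<le> (1 - u) * real_of_ereal (g x) + u * real_of_ereal (g y)"
    if "x \<in> eff_dom g" "y \<in> eff_dom g" "0 \<le> u" "u \<le> 1" for x y u
  proof -
    have "g ((1 - u) *\<^sub>R x + u *\<^sub>R y)
        \<le> ereal ((1 - u) * real_of_ereal (g x) + u * real_of_ereal (g y))"
      using conv[of u x y] that fin[of x] fin[of y]
      by (metis plus_ereal.simps(1) times_ereal.simps(1))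
    moreover from this have dom: "(1 - u) *\<^sub>R x + u *\<^sub>R y \<in> eff_dom g"
      unfolding eff_dom_def by (auto simp: less_ereal.simps intro: le_less_trans)
    ultimately show ?thesis using fin[OF dom] by (metis ereal_less_eq(3))
  qed
  show "convex_lsc (eff_dom g) (\<lambda>x. real_of_ereal (g x))"
    unfolding convex_lsc_def
  proof (intro conjI allI impI)
    show "eff_dom g \<noteq> {}" using g by (simp add: Gamma0_def)
    have "convex (eff_dom g)"
      unfolding convex_alt using conv_dom by blast
    then show "convex_on (eff_dom g) (\<lambda>x. real_of_ereal (g x))"
      by (intro convex_onI) (use conv_dom in auto)
  next
    fix X x M
    assume XM: "\<forall>n. X n \<in> eff_dom g \<and> real_of_ereal (g (X n)) \<le> M" and X: "X \<longlonglongrightarrow> x"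
    have XM': "g (X n) \<le> ereal M" for n
      using XM fin[of "X n"] by (metis ereal_less_eq(3))
    have "g x \<le> ereal M"
    proof (rule ccontr)
      assume "\<not> g x \<le> ereal M"
      then have gt: "ereal M < g x" by simp
      have "g x \<le> Liminf (at x) g" using g by (simp add: Gamma0_def)
      then have "eventually (\<lambda>y. ereal M < g y) (at x)"
        using gt unfolding le_Liminf_iff by blast
      then have "eventually (\<lambda>y. ereal M < g y) (nhds x)"
        using gt by (auto simp: eventually_at_filter elim: eventually_mono)
      then have "eventually (\<lambda>n. ereal M < g (X n)) sequentially"
        using X by (rule eventually_compose_filterlim)
      then show False using XM'
        using eventually_happens'[OF sequentially_bot] by (metis not_less)
    qed
    moreover from this have dom: "x \<in> eff_dom g"
      unfolding eff_dom_def by (auto intro: le_less_trans)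
    ultimately show "x \<in> eff_dom g" "real_of_ereal (g x) \<le> M"
      using fin[OF dom] by (metis ereal_less_eq(3))+
  qed
qed

section \<open>Proximal points\<close>

text \<open>
  Compare \<open>p\<close> with the points of the segment towards \<open>y\<close> and divide by the distance: the quadratic
  remainder vanishes in the limit.
\<close>

lemma prox_variational_inequality:
  fixes f :: "'a::real_inner \<Rightarrow> real"
  assumes f: "convex_on C f" and p: "p \<in> C" and y: "y \<in> C"
    and min: "\<And>y. y \<in> C \<Longrightarrow> f p + (norm (p - u))\<^sup>2 / 2 \<le> f y + (norm (y - u))\<^sup>2 / 2"
  shows "f p + (u - p) \<bullet> (y - p) \<le> f y"
proof -
  have step: "0 \<le> f y - f p + (p - u) \<bullet> (y - p) + e * ((norm (y - p))\<^sup>2 / 2)"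
    if e: "0 < e" "e < 1" for e
  proof -
    let ?q = "(1 - e) *\<^sub>R p + e *\<^sub>R y"
    have qC: "?q \<in> C"
      using convexD_alt[OF convex_on_imp_convex[OF f] p y] e by simp
    have q: "?q - u = (p - u) + e *\<^sub>R (y - p)" by (simp add: algebra_simps)
    have "(norm (?q - u))\<^sup>2 = (norm (p - u))\<^sup>2 + 2 * e * ((p - u) \<bullet> (y - p)) + e\<^sup>2 * (norm (y - p))\<^sup>2"
      unfolding q power2_norm_eq_inner
      by (simp add: inner_add_left inner_add_right inner_commute algebra_simps power2_eq_square)
    moreover have "f ?q \<le> (1 - e) * f p + e * f y"
      using convex_onD[OF f] e p y by simp
    ultimately have "0 \<le> e * (f y - f p + (p - u) \<bullet> (y - p) + e * ((norm (y - p))\<^sup>2 / 2))"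
      using min[OF qC] by (simp add: algebra_simps power2_eq_square)
    with e show ?thesis by (simp add: zero_le_mult_iff)
  qed
  have "0 \<le> f y - f p + (p - u) \<bullet> (y - p)"
  proof (rule tendsto_lowerbound)
    show "((\<lambda>e. f y - f p + (p - u) \<bullet> (y - p) + e * ((norm (y - p))\<^sup>2 / 2))
        \<longlongrightarrow> f y - f p + (p - u) \<bullet> (y - p)) (at_right 0)"
      by (auto intro!: tendsto_eq_intros)
    show "eventually (\<lambda>e. 0 \<le> f y - f p + (p - u) \<bullet> (y - p) + e * ((norm (y - p))\<^sup>2 / 2)) (at_right 0)"
      using eventually_at_right_less[of 0] eventually_at_rightI[of 0 1]
      by (rule_tac eventually_at_rightI[of 0 1]) (use step in auto)
  qed simp
  then show ?thesis by (simp add: inner_diff_left)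
qed

text \<open>
  The parallelogram law turns every minimising sequence of \<open>f + \<parallel>\<cdot> - u\<parallel>\<^sup>2 / 2\<close> into a Cauchy
  sequence, whose limit is a minimiser by lower semicontinuity. Nearest points of closed convex
  sets and the Riesz representation theorem are instances.
\<close>

lemma prox_exists:
  fixes f :: "'a::{real_inner, complete_space} \<Rightarrow> real"
  assumes f: "convex_lsc C f"
  obtains p where "p \<in> C"
    "\<And>y. y \<in> C \<Longrightarrow> f p + (norm (p - u))\<^sup>2 / 2 \<le> f y + (norm (y - u))\<^sup>2 / 2"
proof -
  define h where "h y = f y + (norm (y - u))\<^sup>2 / 2" for y
  \<comment> \<open>the quadratic term dominates the linear minorant of \<open>f\<close>\<close>
  obtain a b where ab: "b \<ge> 0" "\<And>y. y \<in> C \<Longrightarrow> a - b * norm y \<le> f y"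
    using convex_lsc_minorant[OF f] by blast
  have low: "a - b * norm u - b\<^sup>2 / 2 \<le> h y" if "y \<in> C" for y
  proof -
    have "b * norm y \<le> b * norm u + b * norm (y - u)"
      using mult_left_mono[OF norm_triangle_sub[of y u] ab(1)] by (simp add: algebra_simps)
    moreover have "b * norm (y - u) \<le> b\<^sup>2 / 2 + (norm (y - u))\<^sup>2 / 2"
      using sum_squares_bound[of b "norm (y - u)"] by (simp add: power2_eq_square)
    ultimately show ?thesis using ab(2)[OF that] by (simp add: h_def)
  qed
  define m where "m = (INF y\<in>C. h y)"
  have bdd: "bdd_below (h ` C)" using low by (auto simp: bdd_below_def)
  have m_le: "m \<le> h y" if "y \<in> C" for y
    unfolding m_def using that bdd by (simp add: cINF_lower)
  have "\<exists>y\<in>C. h y < m + 1 / real (Suc n)" for n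
  proof -
    have "m < m + 1 / real (Suc n)" by simp
    then show ?thesis
      unfolding m_def using cINF_less_iff[OF convex_lsc_nonempty[OF f] bdd] by blast
  qed
  then obtain X where X: "\<And>n. X n \<in> C" "\<And>n. h (X n) < m + 1 / real (Suc n)"
    by metis
  have close: "(norm (X i - X j))\<^sup>2 \<le> 4 * (1 / real (Suc i) + 1 / real (Suc j))" for i j
  proof -
    let ?q = "(1 - 1/2) *\<^sub>R X i + (1/2) *\<^sub>R X j"
    have q: "?q \<in> C"
      by (rule convexD_alt[OF convex_lsc_convex[OF f] X(1) X(1)]) auto
    have fq: "f ?q \<le> (1 - 1/2) * f (X i) + 1/2 * f (X j)"
      by (rule convex_onD[OF convex_lsc_convex_on[OF f]]) (use X in auto)
    have 1: "?q - u = (1/2) *\<^sub>R ((X i - u) + (X j - u))"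
      by (simp add: algebra_simps flip: scaleR_2 scaleR_add_left)
    have 2: "X i - X j = (X i - u) - (X j - u)" by simp
    have "(norm (?q - u))\<^sup>2 = (norm (X i - u))\<^sup>2 / 2 + (norm (X j - u))\<^sup>2 / 2 - (norm (X i - X j))\<^sup>2 / 4"
      unfolding 1 2 power2_norm_eq_inner
      by (simp add: inner_add_left inner_add_right inner_diff_left inner_diff_right inner_commute field_simps)
    then have hq: "h ?q \<le> (h (X i) + h (X j)) / 2 - (norm (X i - X j))\<^sup>2 / 8"
      using fq by (simp add: h_def field_simps)
    have arith: "v \<le> 4 * (a + b)"
      if "r \<le> (x + y) / 2 - v / 8" "m \<le> r" "x < m + a" "y < m + b" for v a b r x y :: real
      using that by argo
    show ?thesis by (rule arith[OF hq m_le[OF q] X(2) X(2)])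
  qed
  have "Cauchy X"
  proof (rule metric_CauchyI)
    fix e :: real assume "e > 0"
    then have "e\<^sup>2 / 8 > 0" by simp
    then obtain N where N: "inverse (real (Suc N)) < e\<^sup>2 / 8"
      using reals_Archimedean by blast
    show "\<exists>M. \<forall>m\<ge>M. \<forall>n\<ge>M. dist (X m) (X n) < e"
    proof (intro exI allI impI)
      fix i j assume "i \<ge> N" "j \<ge> N"
      then have "1 / real (Suc i) \<le> inverse (real (Suc N))" "1 / real (Suc j) \<le> inverse (real (Suc N))"
        by (simp_all add: field_simps)
      with close[of i j] N have "(norm (X i - X j))\<^sup>2 < e\<^sup>2" by simp
      then show "dist (X i) (X j) < e"
        using \<open>e > 0\<close> by (simp add: dist_norm power2_less_imp_less)
    qed
  qed
  then obtain p where p: "X \<longlonglongrightarrow> p" by (metis Cauchy_convergent_iff convergent_def)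
  have key: "p \<in> C \<and> f p \<le> m - (norm (p - u))\<^sup>2 / 2 + e" if "e > 0" for e
  proof (rule convex_lsc_limit[OF f _ p])
    have "(\<lambda>n. m + 1 / real (Suc n) - (norm (X n - u))\<^sup>2 / 2) \<longlonglongrightarrow> m + 0 - (norm (p - u))\<^sup>2 / 2"
      by (intro tendsto_intros p LIMSEQ_Suc[OF lim_1_over_n]) simp
    then have "eventually (\<lambda>n. m + 1 / real (Suc n) - (norm (X n - u))\<^sup>2 / 2
        < m - (norm (p - u))\<^sup>2 / 2 + e) sequentially"
      by (rule order_tendstoD) (use that in simp)
    then show "eventually (\<lambda>n. X n \<in> C \<and> f (X n) \<le> m - (norm (p - u))\<^sup>2 / 2 + e) sequentially"
    proof eventually_elim
      case (elim n)
      with X(1)[of n] X(2)[of n] show ?case by (simp add: h_def)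
    qed
  qed
  have "p \<in> C" using key[of 1] by simp
  moreover have "h p \<le> m"
    unfolding h_def by (rule field_le_epsilon) (use key in fastforce)
  ultimately show ?thesis
    using that[of p] m_le unfolding h_def by (meson order_trans)
qed

lemma prox_real:
  fixes f :: "'a::{real_inner, complete_space} \<Rightarrow> real"
  assumes f: "convex_lsc C f"
    and G: "\<And>x. x \<in> C \<Longrightarrow> G x = ereal (f x)" "\<And>x. x \<notin> C \<Longrightarrow> G x = \<infinity>"
  shows "prox G u \<in> C" and "\<And>y. y \<in> C \<Longrightarrow> f (prox G u) + (u - prox G u) \<bullet> (y - prox G u) \<le> f y"
proof -
  let ?H = "\<lambda>z. G z + ereal ((norm (z - u))\<^sup>2 / 2)"
  obtain p where p: "p \<in> C"
    "\<And>y. y \<in> C \<Longrightarrow> f p + (norm (p - u))\<^sup>2 / 2 \<le> f y + (norm (y - u))\<^sup>2 / 2"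
    using prox_exists[OF f, of u] by blast
  have "is_arg_min ?H (\<lambda>_. True) p"
    unfolding is_arg_min_linorder
  proof (intro conjI allI impI TrueI)
    fix y show "?H p \<le> ?H y"
      using p G by (cases "y \<in> C") auto
  qed
  then have "is_arg_min ?H (\<lambda>_. True) (prox G u)"
    unfolding prox_def arg_min_def by (rule someI)
  then have min: "?H (prox G u) \<le> ?H y" for y
    unfolding is_arg_min_linorder by simp
  show C: "prox G u \<in> C"
  proof (rule ccontr)
    assume "prox G u \<notin> C"
    then show False using min[of p] G(2) G(1)[OF p(1)] by simp
  qed
  show "f (prox G u) + (u - prox G u) \<bullet> (y - prox G u) \<le> f y" if "y \<in> C" for y
  proof (rule prox_variational_inequality[OF convex_lsc_convex_on[OF f] C that])
    fix v assume "v \<in> C"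
    then show "f (prox G u) + (norm (prox G u - u))\<^sup>2 / 2 \<le> f v + (norm (v - u))\<^sup>2 / 2"
      using min[of v] G(1)[OF C] G(1)[of v] by simp
  qed
qed

section \<open>Weak convergence\<close>

lemma convex_lsc_zero:
  assumes "convex S" "closed S" "S \<noteq> {}"
  shows "convex_lsc S (\<lambda>_. 0)"
  using assms unfolding convex_lsc_def closed_sequential_limits
  by (auto simp: convex_on_const)

lemma nearest_point_exists:
  fixes S :: "'a::{real_inner, complete_space} set"
  assumes "convex S" "closed S" "S \<noteq> {}"
  obtains p where "p \<in> S" "\<And>y. y \<in> S \<Longrightarrow> (x - p) \<bullet> (y - p) \<le> 0"
proof -
  obtain p where p: "p \<in> S"
    "\<And>y. y \<in> S \<Longrightarrow> (0::real) + (norm (p - x))\<^sup>2 / 2 \<le> 0 + (norm (y - x))\<^sup>2 / 2"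
    using prox_exists[OF convex_lsc_zero[OF assms], of x] by blast
  have conv: "convex_on S (\<lambda>_. 0::real)" using assms(1) by (simp add: convex_on_const)
  show ?thesis
    using that[of p] prox_variational_inequality[OF conv p(1) _ p(2)] p(1) by simp
qed

lemma tendsto_imp_weakly_converges: "X \<longlonglongrightarrow> x \<Longrightarrow> weakly_converges X x"
  unfolding weakly_converges_def by (auto intro: tendsto_intros)

text \<open>
  For the point \<open>p\<close> of \<open>S\<close> nearest to the weak limit \<open>x\<close>, every member of the sequence satisfies
  \<open>(x - p) \<bullet> (X n - p) \<le> 0\<close>, and the left-hand side tends to \<open>\<parallel>x - p\<parallel>\<^sup>2\<close>.
\<close>

lemma closed_convex_weakly_closed:
  fixes S :: "'a::{real_inner, complete_space} set"
  assumes S: "convex S" "closed S" and X: "eventually (\<lambda>n. X n \<in> S) sequentially" "weakly_converges X x"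
  shows "x \<in> S"
proof -
  have "S \<noteq> {}" using eventually_happens'[OF sequentially_bot X(1)] by blast
  then obtain p where p: "p \<in> S" "\<And>y. y \<in> S \<Longrightarrow> (x - p) \<bullet> (y - p) \<le> 0"
    using nearest_point_exists[OF S] by blast
  have "(\<lambda>n. X n \<bullet> (x - p) - p \<bullet> (x - p)) \<longlonglongrightarrow> x \<bullet> (x - p) - p \<bullet> (x - p)"
    using X(2) unfolding weakly_converges_def by (intro tendsto_diff tendsto_const) simp
  moreover have "eventually (\<lambda>n. X n \<bullet> (x - p) - p \<bullet> (x - p) \<le> 0) sequentially"
    using X(1)
  proof eventually_elim
    case (elim n)
    then show ?case using p(2)[of "X n"] by (simp add: inner_diff inner_commute algebra_simps)
  qed
  ultimately have "x \<bullet> (x - p) - p \<bullet> (x - p) \<le> 0"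
    by (rule tendsto_upperbound) simp
  then have "(x - p) \<bullet> (x - p) \<le> 0" by (simp add: inner_diff_left)
  then have "x = p" by (metis eq_iff_diff_eq_0 inner_ge_zero inner_eq_zero_iff order_antisym)
  with p(1) show ?thesis by simp
qed

lemma convex_lsc_weak_limit:
  fixes f :: "'a::{real_inner, complete_space} \<Rightarrow> real"
  assumes f: "convex_lsc C f"
    and X: "eventually (\<lambda>n. X n \<in> C \<and> f (X n) \<le> M) sequentially" "weakly_converges X x"
  shows "x \<in> C \<and> f x \<le> M"
proof -
  have "closed {y \<in> C. f y \<le> M}"
    unfolding closed_sequential_limits
  proof (intro allI impI)
    fix Y l assume Y: "(\<forall>n. Y n \<in> {y \<in> C. f y \<le> M}) \<and> Y \<longlonglongrightarrow> l"
    then have "eventually (\<lambda>n. Y n \<in> C \<and> f (Y n) \<le> M) sequentially" by simp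
    then show "l \<in> {y \<in> C. f y \<le> M}"
      using convex_lsc_limit[OF f] Y by blast
  qed
  moreover have "convex {y \<in> C. f y \<le> M}"
    unfolding convex_alt
  proof (intro ballI allI impI)
    fix a b u assume *: "a \<in> {y \<in> C. f y \<le> M}" "b \<in> {y \<in> C. f y \<le> M}" "0 \<le> u \<and> (u::real) \<le> 1"
    have "f ((1 - u) *\<^sub>R a + u *\<^sub>R b) \<le> (1 - u) * f a + u * f b"
      using convex_onD[OF convex_lsc_convex_on[OF f]] * by simp
    also have "\<dots> \<le> (1 - u) * M + u * M"
      using * by (intro add_mono mult_left_mono) auto
    finally show "(1 - u) *\<^sub>R a + u *\<^sub>R b \<in> {y \<in> C. f y \<le> M}"
      using convexD_alt[OF convex_lsc_convex[OF f]] * by (simp add: algebra_simps)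
  qed
  ultimately show ?thesis
    using closed_convex_weakly_closed[of "{y \<in> C. f y \<le> M}" X x] X by simp
qed

text \<open>
  A bounded linear functional \<open>\<phi>\<close> is represented by the minimiser of \<open>\<parallel>\<cdot>\<parallel>\<^sup>2 / 2 - \<phi>\<close>.
\<close>

lemma riesz_representation:
  fixes \<phi> :: "'a::{real_inner, complete_space} \<Rightarrow> real"
  assumes lin: "linear \<phi>" and bnd: "\<And>y. \<bar>\<phi> y\<bar> \<le> B * norm y"
  obtains p where "\<And>y. \<phi> y = p \<bullet> y"
proof -
  have bl: "bounded_linear \<phi>"
    using lin bnd by (auto intro!: bounded_linear_intro[where K = B]
        simp: linear_add linear_scale mult.commute)
  have conv: "convex_on UNIV (\<lambda>y. - \<phi> y)"
    by (rule convex_onI) (auto simp: linear_add[OF lin] linear_scale[OF lin])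
  have lsc: "convex_lsc UNIV (\<lambda>y. - \<phi> y)"
    unfolding convex_lsc_def
  proof (intro conjI allI impI conv)
    fix X x M assume M: "\<forall>n. X n \<in> UNIV \<and> - \<phi> (X n) \<le> M" and X: "X \<longlonglongrightarrow> x"
    have "(\<lambda>n. - \<phi> (X n)) \<longlonglongrightarrow> - \<phi> x"
      by (intro tendsto_minus bounded_linear.tendsto[OF bl] X)
    then show "- \<phi> x \<le> M" using M by (intro LIMSEQ_le_const2) auto
  qed auto
  obtain p where "p \<in> UNIV" and
    p: "\<And>y. y \<in> UNIV \<Longrightarrow> - \<phi> p + (norm (p - 0))\<^sup>2 / 2 \<le> - \<phi> y + (norm (y - 0))\<^sup>2 / 2"
    using prox_exists[OF lsc, of 0] by blast
  have le: "\<phi> v \<le> p \<bullet> v" for v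
    using prox_variational_inequality[OF conv _ _ p, of "p + v"]
    by (simp add: linear_add[OF lin])
  show ?thesis
  proof (rule that)
    fix y
    show "\<phi> y = p \<bullet> y" using le[of y] le[of "- y"] by (simp add: linear_neg[OF lin])
  qed
qed

text \<open>
  A diagonal subsequence makes \<open>X n \<bullet> d\<close> converge for every \<open>d\<close> in a countable dense set. Since
  \<open>X\<close> is bounded, \<open>X n \<bullet> y\<close> then converges for every \<open>y\<close>, and its limit is a bounded linear
  functional of \<open>y\<close>.
\<close>

lemma bounded_weakly_convergent_subsequence:
  fixes X :: "nat \<Rightarrow> 'a::{real_inner, complete_space}"
  assumes sep: "separable_space (euclidean :: 'a topology)" and B: "\<And>n. norm (X n) \<le> B"
  obtains r x where "strict_mono r" "weakly_converges (X \<circ> r) x"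
proof -
  obtain D :: "'a set" where D: "countable D" "closure D = UNIV"
    using sep unfolding separable_space_def by auto
  have B0: "0 \<le> B" using B[of 0] norm_ge_zero order_trans by blast
  \<comment> \<open>the normalisation makes the bound uniform in \<open>d\<close>\<close>
  have "norm ((X n \<bullet> d) / (1 + norm d)) \<le> B" for n d
  proof -
    have "\<bar>X n \<bullet> d\<bar> \<le> norm (X n) * norm d" by (rule Cauchy_Schwarz_ineq2)
    also have "\<dots> \<le> B * (1 + norm d)" using B B0 by (intro mult_mono) auto
    finally have "\<bar>X n \<bullet> d\<bar> / (1 + norm d) \<le> B"
      by (subst pos_divide_le_eq) (auto simp: add_pos_nonneg)
    then show ?thesis by (simp add: abs_of_pos add_pos_nonneg)
  qed
  then obtain r where r: "strict_mono r"
    "\<And>d. d \<in> D \<Longrightarrow> \<exists>l. (\<lambda>n. (X (r n) \<bullet> d) / (1 + norm d)) \<longlonglongrightarrow> l"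
    using function_convergent_subsequence[OF D(1), of "\<lambda>n d. (X n \<bullet> d) / (1 + norm d)" B]
    by blast
  have convD: "convergent (\<lambda>n. X (r n) \<bullet> d)" if d: "d \<in> D" for d
  proof -
    obtain l where "(\<lambda>n. (X (r n) \<bullet> d) / (1 + norm d)) \<longlonglongrightarrow> l" using r(2)[OF d] by blast
    then have "(\<lambda>n. (X (r n) \<bullet> d) / (1 + norm d) * (1 + norm d)) \<longlonglongrightarrow> l * (1 + norm d)"
      by (rule tendsto_mult_right)
    moreover have "1 + norm d \<noteq> 0" using norm_ge_zero[of d] by linarith
    ultimately show ?thesis by (auto simp: convergent_def)
  qed
  have conv: "convergent (\<lambda>n. X (r n) \<bullet> y)" for y
    unfolding Cauchy_convergent_iff[symmetric]
  proof (rule metric_CauchyI)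
    fix e :: real assume e: "e > 0"
    define s where "s = e / (3 * (B + 1))"
    have s: "s > 0" "B * s \<le> e / 3" using e B0 by (auto simp: s_def field_simps)
    obtain d where d: "d \<in> D" "dist d y < s"
      using D(2) s(1) closure_approachable[of y D] by auto
    have near: "\<bar>X (r n) \<bullet> y - X (r n) \<bullet> d\<bar> \<le> e / 3" for n
    proof -
      have "\<bar>X (r n) \<bullet> (y - d)\<bar> \<le> norm (X (r n)) * norm (y - d)" by (rule Cauchy_Schwarz_ineq2)
      also have "\<dots> \<le> B * s"
        using B d B0 by (intro mult_mono) (auto simp: dist_norm norm_minus_commute)
      finally show ?thesis using s by (simp add: inner_diff_right)
    qed
    have "Cauchy (\<lambda>n. X (r n) \<bullet> d)" using convD[OF d(1)] by (simp add: Cauchy_convergent_iff)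
    then obtain N where N: "\<And>m n. m \<ge> N \<Longrightarrow> n \<ge> N \<Longrightarrow> dist (X (r m) \<bullet> d) (X (r n) \<bullet> d) < e / 3"
      using e metric_CauchyD[of "\<lambda>n. X (r n) \<bullet> d" "e / 3"] by (metis divide_pos_pos zero_less_numeral)
    show "\<exists>M. \<forall>m\<ge>M. \<forall>n\<ge>M. dist (X (r m) \<bullet> y) (X (r n) \<bullet> y) < e"
    proof (intro exI allI impI)
      fix m n assume mn: "m \<ge> N" "n \<ge> N"
      show "dist (X (r m) \<bullet> y) (X (r n) \<bullet> y) < e"
        using near[of m] near[of n] N[OF mn] unfolding dist_real_def by linarith
    qed
  qed
  define \<phi> where "\<phi> y = lim (\<lambda>n. X (r n) \<bullet> y)" for y
  have \<phi>: "(\<lambda>n. X (r n) \<bullet> y) \<longlonglongrightarrow> \<phi> y" for y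
    using conv unfolding \<phi>_def convergent_LIMSEQ_iff .
  have "linear \<phi>"
  proof (rule linearI)
    fix a b c
    show "\<phi> (a + b) = \<phi> a + \<phi> b"
      using LIMSEQ_unique[OF \<phi>[of "a + b"]] tendsto_add[OF \<phi>[of a] \<phi>[of b]]
      by (simp add: inner_add_right)
    show "\<phi> (c *\<^sub>R a) = c *\<^sub>R \<phi> a"
      using LIMSEQ_unique[OF \<phi>[of "c *\<^sub>R a"]] tendsto_mult_left[OF \<phi>[of a], of c] by simp
  qed
  moreover have "\<bar>\<phi> y\<bar> \<le> B * norm y" for y
  proof (rule LIMSEQ_le_const2[OF tendsto_rabs[OF \<phi>]], intro exI allI impI)
    fix n
    have "\<bar>X (r n) \<bullet> y\<bar> \<le> norm (X (r n)) * norm y" by (rule Cauchy_Schwarz_ineq2)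
    also have "\<dots> \<le> B * norm y" using B by (intro mult_right_mono) auto
    finally show "\<bar>X (r n) \<bullet> y\<bar> \<le> B * norm y" .
  qed
  ultimately obtain x where x: "\<And>y. \<phi> y = x \<bullet> y"
    using riesz_representation[of \<phi> B] by blast
  show ?thesis
    by (rule that[OF r(1), of x]) (use \<phi> x in \<open>simp add: weakly_converges_def\<close>)
qed

text \<open>
  Two weak cluster points \<open>x\<close> and \<open>x'\<close> are separated by \<open>\<cdot> \<bullet> (x - x')\<close>; if this functional
  converges along the whole sequence, then \<open>x \<bullet> (x - x') = x' \<bullet> (x - x')\<close>, so \<open>x = x'\<close>.
\<close>

lemma opial:
  fixes X :: "nat \<Rightarrow> 'a::{real_inner, complete_space}"
  assumes sep: "separable_space (euclidean :: 'a topology)" and B: "\<And>n. norm (X n) \<le> B"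
    and cluster: "\<And>r x. strict_mono r \<Longrightarrow> weakly_converges (X \<circ> r) x \<Longrightarrow> x \<in> S"
    and conv: "\<And>x x'. x \<in> S \<Longrightarrow> x' \<in> S \<Longrightarrow> convergent (\<lambda>n. X n \<bullet> (x - x'))"
  shows "\<exists>x\<in>S. weakly_converges X x"
proof -
  obtain r x where r: "strict_mono r" "weakly_converges (X \<circ> r) x"
    using bounded_weakly_convergent_subsequence[of X, OF sep B] by blast
  have x: "x \<in> S" using cluster r by blast
  have "weakly_converges X x"
  proof (rule ccontr)
    assume "\<not> weakly_converges X x"
    then obtain y where "\<not> (\<lambda>n. X n \<bullet> y) \<longlonglongrightarrow> x \<bullet> y" by (auto simp: weakly_converges_def)
    then obtain e where e: "e > 0" "\<not> eventually (\<lambda>n. dist (X n \<bullet> y) (x \<bullet> y) < e) sequentially"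
      by (auto simp: tendsto_iff)
    then have "\<exists>\<^sub>F n in sequentially. e \<le> dist (X n \<bullet> y) (x \<bullet> y)"
      by (simp add: frequently_def not_le)
    then have inf: "infinite {n. e \<le> dist (X n \<bullet> y) (x \<bullet> y)}"
      by (simp add: cofinite_eq_sequentially[symmetric] frequently_cofinite)
    define q where "q = enumerate {n. e \<le> dist (X n \<bullet> y) (x \<bullet> y)}"
    have q: "strict_mono q" "\<And>n. e \<le> dist (X (q n) \<bullet> y) (x \<bullet> y)"
      using strict_mono_enumerate[OF inf] enumerate_in_set[OF inf] by (auto simp: q_def)
    obtain s x' where s: "strict_mono s" "weakly_converges ((X \<circ> q) \<circ> s) x'"
      using bounded_weakly_convergent_subsequence[of "X \<circ> q", OF sep] B by (metis comp_apply)
    have qs: "strict_mono (q \<circ> s)" using q(1) s(1) by (rule strict_mono_o)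
    have x': "x' \<in> S" using cluster[OF qs] s(2) by (simp add: comp_assoc)
    obtain l where l: "(\<lambda>n. X n \<bullet> (x - x')) \<longlonglongrightarrow> l"
      using conv[OF x x'] by (auto simp: convergent_def)
    have "x \<bullet> (x - x') = l"
      using LIMSEQ_unique[OF _ LIMSEQ_subseq_LIMSEQ[OF l r(1)]] r(2)
      by (auto simp: weakly_converges_def o_def)
    moreover have "x' \<bullet> (x - x') = l"
      using LIMSEQ_unique[OF _ LIMSEQ_subseq_LIMSEQ[OF l qs]] s(2)
      by (auto simp: weakly_converges_def o_def)
    ultimately have "(x - x') \<bullet> (x - x') = 0" by (simp add: inner_diff_left)
    then have "x' = x" by simp
    then have "(\<lambda>n. X (q (s n)) \<bullet> y) \<longlonglongrightarrow> x \<bullet> y"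
      using s(2) by (auto simp: weakly_converges_def o_def)
    then have "eventually (\<lambda>n. dist (X (q (s n)) \<bullet> y) (x \<bullet> y) < e) sequentially"
      using e(1) by (auto simp: tendsto_iff)
    then obtain n where "dist (X (q (s n)) \<bullet> y) (x \<bullet> y) < e"
      using eventually_happens'[OF sequentially_bot] by blast
    with q(2)[of "s n"] show False by linarith
  qed
  with x show ?thesis by blast
qed

section \<open>Gap functions and variational inequalities\<close>

text \<open>The real-valued form of \<^const>\<open>H_fun\<close> on the domain of the convex function.\<close>

definition gap :: "('a::real_inner \<Rightarrow> 'a) \<Rightarrow> ('a \<Rightarrow> real) \<Rightarrow> 'a \<Rightarrow> 'a \<Rightarrow> real" where
  "gap F f x y = F y \<bullet> (x - y) + f x - f y"

definition vi_solutions :: "('a::real_inner \<Rightarrow> 'a) \<Rightarrow> ('a \<Rightarrow> real) \<Rightarrow> 'a set \<Rightarrow> 'a set" where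
  "vi_solutions F f C = {x \<in> C. \<forall>y\<in>C. 0 \<le> gap F f y x}"

lemma gap_antisymmetric:
  assumes "monotone_operator F"
  shows "gap F f x y \<le> - gap F f y x"
proof -
  have "0 \<le> (F x - F y) \<bullet> (x - y)" using assms by (simp add: monotone_operator_def)
  then show ?thesis by (simp add: gap_def inner_diff inner_commute algebra_simps)
qed

lemma convex_on_gap:
  assumes "convex_on C f"
  shows "convex_on C (\<lambda>x. gap F f x y)"
proof (rule convex_onI)
  fix u :: real and a b assume u: "u > 0" "u < 1" and ab: "a \<in> C" "b \<in> C"
  have "f ((1 - u) *\<^sub>R a + u *\<^sub>R b) \<le> (1 - u) * f a + u * f b"
    using convex_onD[OF assms] u ab by simp
  then show "gap F f ((1 - u) *\<^sub>R a + u *\<^sub>R b) y \<le> (1 - u) * gap F f a y + u * gap F f b y"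
    by (simp add: gap_def inner_diff_right inner_add_right algebra_simps)
qed (rule convex_on_imp_convex[OF assms])

text \<open>
  Minty's lemma: testing with the points \<open>(1 - e) x + e y\<close> and letting \<open>e\<close> tend to \<open>0\<close> moves the
  evaluation of \<open>F\<close> from the test point to \<open>x\<close>.
\<close>

lemma minty:
  assumes f: "convex_on C f" and F: "monotone_operator F" "continuous_on UNIV F"
  shows "x \<in> vi_solutions F f C \<longleftrightarrow> x \<in> C \<and> (\<forall>y\<in>C. gap F f x y \<le> 0)"
proof
  assume x: "x \<in> vi_solutions F f C"
  have "gap F f x y \<le> 0" if "y \<in> C" for y
  proof -
    have "0 \<le> gap F f y x" using x that by (simp add: vi_solutions_def)
    with gap_antisymmetric[OF F(1), of f x y] show ?thesis by linarith
  qed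
  with x show "x \<in> C \<and> (\<forall>y\<in>C. gap F f x y \<le> 0)" by (simp add: vi_solutions_def)
next
  assume x: "x \<in> C \<and> (\<forall>y\<in>C. gap F f x y \<le> 0)"
  have "0 \<le> gap F f y x" if y: "y \<in> C" for y
  proof -
    define q where "q e = x + e *\<^sub>R (y - x)" for e
    have q: "q e = (1 - e) *\<^sub>R x + e *\<^sub>R y" for e by (simp add: q_def algebra_simps)
    have "0 \<le> F (q e) \<bullet> (y - x) + f y - f x" if e: "0 < e" "e < 1" for e
    proof -
      have "q e \<in> C"
        unfolding q using convexD_alt[OF convex_on_imp_convex[OF f], of x y e] x y e by simp
      then have "gap F f x (q e) \<le> 0" using x by blast
      moreover have "f (q e) \<le> (1 - e) * f x + e * f y"
        unfolding q using convex_onD[OF f] x y e by simp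
      moreover have "gap F f x (q e) = - (e * (F (q e) \<bullet> (y - x))) + f x - f (q e)"
        by (simp add: gap_def q_def)
      ultimately have "0 \<le> e * (F (q e) \<bullet> (y - x) + f y - f x)" by (simp add: algebra_simps)
      with e show ?thesis by (simp add: zero_le_mult_iff)
    qed
    then have "eventually (\<lambda>e. 0 \<le> F (q e) \<bullet> (y - x) + f y - f x) (at_right 0)"
      by (intro eventually_at_rightI[of 0 1]) auto
    moreover have "((\<lambda>e. F (q e) \<bullet> (y - x) + f y - f x) \<longlongrightarrow> F x \<bullet> (y - x) + f y - f x) (at_right 0)"
    proof (intro tendsto_intros)
      have "(q \<longlongrightarrow> x + 0 *\<^sub>R (y - x)) (at_right 0)"
        unfolding q_def by (intro tendsto_intros)
      then show "((\<lambda>e. F (q e)) \<longlongrightarrow> F x) (at_right 0)"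
        using F(2) by (intro isCont_tendsto_compose[of _ F]) (auto simp: continuous_on_eq_continuous_at)
    qed
    ultimately have "0 \<le> F x \<bullet> (y - x) + f y - f x"
      by (intro tendsto_lowerbound[of _ _ "at_right (0::real)"]) auto
    then show ?thesis by (simp add: gap_def)
  qed
  with x show "x \<in> vi_solutions F f C" by (simp add: vi_solutions_def)
qed

text \<open>
  For fixed \<open>y\<close> the gap is, up to weakly continuous terms, the function \<open>f\<close>, which is weakly lower
  semicontinuous. Only approximate inequalities are assumed, because averages satisfy no more.
\<close>

lemma gap_weak_limit:
  fixes F :: "'a::{real_inner, complete_space} \<Rightarrow> 'a"
  assumes f: "convex_lsc C f" and X: "eventually (\<lambda>n. X n \<in> C) sequentially" "weakly_converges X x"
    and small: "\<And>e. e > 0 \<Longrightarrow> eventually (\<lambda>n. gap F f (X n) y \<le> e) sequentially"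
  shows "x \<in> C \<and> gap F f x y \<le> 0"
proof -
  have lim: "(\<lambda>n. F y \<bullet> (X n - y)) \<longlonglongrightarrow> F y \<bullet> (x - y)"
  proof -
    have "(\<lambda>n. X n \<bullet> F y - F y \<bullet> y) \<longlonglongrightarrow> x \<bullet> F y - F y \<bullet> y"
      using X(2) unfolding weakly_converges_def by (intro tendsto_diff tendsto_const) simp
    then show ?thesis by (simp add: inner_diff_right inner_commute)
  qed
  have key: "x \<in> C \<and> f x \<le> f y - F y \<bullet> (x - y) + e" if e: "e > 0" for e
  proof (rule convex_lsc_weak_limit[OF f _ X(2)])
    have "eventually (\<lambda>n. F y \<bullet> (x - y) - e / 2 < F y \<bullet> (X n - y)) sequentially"
      using lim by (rule order_tendstoD) (use e in simp)
    moreover have "eventually (\<lambda>n. gap F f (X n) y \<le> e / 2) sequentially"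
      by (rule small) (use e in simp)
    ultimately show "eventually (\<lambda>n. X n \<in> C \<and> f (X n) \<le> f y - F y \<bullet> (x - y) + e) sequentially"
      using X(1)
    proof eventually_elim
      case (elim n)
      then show ?case unfolding gap_def by argo
    qed
  qed
  have "f x \<le> f y - F y \<bullet> (x - y)"
    by (rule field_le_epsilon) (use key in fastforce)
  with key[of 1] show ?thesis by (simp add: gap_def)
qed

lemma vi_solutions_closed_convex:
  fixes F :: "'a::{real_inner, complete_space} \<Rightarrow> 'a"
  assumes f: "convex_lsc C f" and F: "monotone_operator F" "continuous_on UNIV F"
  shows "closed (vi_solutions F f C)" and "convex (vi_solutions F f C)"
proof -
  note m = minty[OF convex_lsc_convex_on[OF f] F]
  show "closed (vi_solutions F f C)"
    unfolding closed_sequential_limits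
  proof (intro allI impI)
    fix X x assume X: "(\<forall>n. X n \<in> vi_solutions F f C) \<and> X \<longlonglongrightarrow> x"
    have lim: "x \<in> C \<and> gap F f x y \<le> 0" if y: "y \<in> C" for y
    proof (rule gap_weak_limit[OF f])
      show "eventually (\<lambda>n. X n \<in> C) sequentially" using X m by simp
      show "weakly_converges X x" using X tendsto_imp_weakly_converges by blast
      fix e :: real assume "e > 0"
      have "gap F f (X n) y \<le> e" for n
      proof -
        have "gap F f (X n) y \<le> 0" using X y m by simp
        with \<open>e > 0\<close> show ?thesis by simp
      qed
      then show "eventually (\<lambda>n. gap F f (X n) y \<le> e) sequentially" by simp
    qed
    with convex_lsc_nonempty[OF f] show "x \<in> vi_solutions F f C" unfolding m by blast
  qed
  show "convex (vi_solutions F f C)"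
    unfolding convex_alt
  proof (intro ballI allI impI)
    fix a b and u :: real
    assume ab: "a \<in> vi_solutions F f C" "b \<in> vi_solutions F f C" and u: "0 \<le> u \<and> u \<le> 1"
    have "gap F f ((1 - u) *\<^sub>R a + u *\<^sub>R b) y \<le> 0" if y: "y \<in> C" for y
    proof -
      have "gap F f ((1 - u) *\<^sub>R a + u *\<^sub>R b) y \<le> (1 - u) * gap F f a y + u * gap F f b y"
        using convex_onD[OF convex_on_gap[OF convex_lsc_convex_on[OF f]]] u ab m by simp
      also have "\<dots> \<le> 0"
        using ab u y unfolding m by (simp add: add_nonpos_nonpos mult_nonneg_nonpos)
      finally show ?thesis .
    qed
    then show "(1 - u) *\<^sub>R a + u *\<^sub>R b \<in> vi_solutions F f C"
      using convexD_alt[OF convex_lsc_convex[OF f], of a b u] ab u unfolding m by simp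
  qed
qed

section \<open>Weighted averages and quasi-Fejer sequences\<close>

definition weighted_average :: "(nat \<Rightarrow> real) \<Rightarrow> (nat \<Rightarrow> 'a::real_vector) \<Rightarrow> nat \<Rightarrow> 'a" where
  "weighted_average t X K = (1 / (\<Sum>k=1..K. t k)) *\<^sub>R (\<Sum>k=1..K. t k *\<^sub>R X k)"

lemma weighted_average_convex:
  fixes f :: "'a::real_vector \<Rightarrow> real"
  assumes f: "convex_on C f" and t: "\<And>k. k \<ge> 1 \<Longrightarrow> t k > 0" and X: "\<And>k. k \<ge> 1 \<Longrightarrow> X k \<in> C"
    and K: "K \<ge> 1"
  shows "weighted_average t X K \<in> C"
    and "f (weighted_average t X K) \<le> (\<Sum>k=1..K. t k * f (X k)) / (\<Sum>k=1..K. t k)"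
proof -
  define T where "T = (\<Sum>k=1..K. t k)"
  have T: "T > 0" unfolding T_def using K t by (intro sum_pos) auto
  have avg: "weighted_average t X K = (\<Sum>k\<in>{1..K}. (t k / T) *\<^sub>R X k)"
    unfolding weighted_average_def T_def[symmetric] by (simp add: scaleR_sum_right)
  have sum1: "(\<Sum>k\<in>{1..K}. t k / T) = 1"
    using T unfolding sum_divide_distrib[symmetric] T_def[symmetric] by simp
  have nonneg: "0 \<le> t k / T" if "k \<in> {1..K}" for k
    using that T t[of k] by simp
  show "weighted_average t X K \<in> C"
    unfolding avg by (rule convex_sum) (use convex_on_imp_convex[OF f] sum1 nonneg X in auto)
  have "f (\<Sum>k\<in>{1..K}. (t k / T) *\<^sub>R X k) \<le> (\<Sum>k\<in>{1..K}. (t k / T) * f (X k))"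
    by (rule convex_on_sum[OF _ _ f sum1]) (use K nonneg X in auto)
  then show "f (weighted_average t X K) \<le> (\<Sum>k=1..K. t k * f (X k)) / (\<Sum>k=1..K. t k)"
    unfolding avg T_def[symmetric] by (simp add: sum_divide_distrib)
qed

lemma weighted_average_norm_le:
  fixes X :: "nat \<Rightarrow> 'a::real_normed_vector"
  assumes t: "\<And>k. k \<ge> 1 \<Longrightarrow> t k > 0" and X: "\<And>k. k \<ge> 1 \<Longrightarrow> norm (X k) \<le> B" and B: "0 \<le> B"
  shows "norm (weighted_average t X K) \<le> B"
proof (cases "K \<ge> 1")
  case True
  have "weighted_average t X K \<in> cball 0 B"
    by (rule weighted_average_convex(1)[of _ "\<lambda>_. 0"]) (use t X True in \<open>auto simp: convex_on_const\<close>)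
  then show ?thesis by simp
qed (use B in \<open>simp add: weighted_average_def\<close>)

lemma weighted_average_tendsto:
  fixes a :: "nat \<Rightarrow> real"
  assumes t: "\<And>k. k \<ge> 1 \<Longrightarrow> t k > 0"
    and T: "filterlim (\<lambda>K. \<Sum>k=1..K. t k) at_top sequentially" and a: "a \<longlonglongrightarrow> l"
  shows "weighted_average t a \<longlonglongrightarrow> l"
proof (rule tendstoI)
  fix e :: real assume e: "e > 0"
  have "eventually (\<lambda>k. \<bar>a k - l\<bar> < e / 2) sequentially"
    using tendstoD[OF a, of "e / 2"] e by (simp add: dist_real_def)
  then obtain N where N: "\<And>k. k \<ge> N \<Longrightarrow> \<bar>a k - l\<bar> < e / 2"
    by (auto simp: eventually_sequentially)
  \<comment> \<open>the contribution of the early terms, which the diverging total weight outweighs\<close>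
  define D where "D = (\<Sum>k=1..N. t k * \<bar>a k - l\<bar>)"
  have "eventually (\<lambda>K. 2 * D / e + 1 \<le> (\<Sum>k=1..K. t k)) sequentially"
    using T by (simp add: filterlim_at_top)
  moreover have "eventually (\<lambda>K. 1 \<le> (\<Sum>k=1..K. t k)) sequentially"
    using T by (simp add: filterlim_at_top)
  ultimately show "eventually (\<lambda>K. dist (weighted_average t a K) l < e) sequentially"
    using eventually_ge_at_top[of N]
  proof eventually_elim
    case (elim K)
    define T where "T = (\<Sum>k=1..K. t k)"
    have "1 \<le> T" "2 * D / e + 1 \<le> T" using elim by (simp_all only: T_def)
    then have "T > 0" "2 * D / e < T" by linarith+
    then have T: "T > 0" "D < e / 2 * T" using e by (simp_all add: field_simps)
    have "\<bar>\<Sum>k=1..K. t k * (a k - l)\<bar> \<le> (\<Sum>k=1..K. \<bar>t k * (a k - l)\<bar>)" by (rule sum_abs)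
    also have "\<dots> \<le> (\<Sum>k=1..K. t k * (e / 2) + (if k \<le> N then t k * \<bar>a k - l\<bar> else 0))"
    proof (rule sum_mono)
      fix k assume k: "k \<in> {1..K}"
      then have tk: "t k > 0" using t by simp
      show "\<bar>t k * (a k - l)\<bar> \<le> t k * (e / 2) + (if k \<le> N then t k * \<bar>a k - l\<bar> else 0)"
        using tk e N[of k] by (auto simp: abs_mult)
    qed
    also have "\<dots> = e / 2 * T + (\<Sum>k\<in>{1..K}. if k \<le> N then t k * \<bar>a k - l\<bar> else 0)"
      by (simp add: sum.distrib T_def sum_distrib_left mult.commute)
    also have "(\<Sum>k\<in>{1..K}. if k \<le> N then t k * \<bar>a k - l\<bar> else 0) = D"
      unfolding D_def using elim by (subst sum.inter_filter[symmetric]) (auto intro!: sum.cong)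
    finally have small: "\<bar>\<Sum>k=1..K. t k * (a k - l)\<bar> < e * T" using T by linarith
    have "weighted_average t a K - l = (\<Sum>k=1..K. t k * (a k - l)) / T"
      using T unfolding right_diff_distrib sum_subtractf sum_distrib_right[symmetric]
        weighted_average_def T_def[symmetric] by (simp add: field_simps)
    then have "dist (weighted_average t a K) l = \<bar>\<Sum>k=1..K. t k * (a k - l)\<bar> / T"
      using T(1) by (simp only: dist_real_def abs_divide abs_of_pos)
    also have "\<dots> < e" using small T(1) by (simp only: pos_divide_less_eq)
    finally show "dist (weighted_average t a K) l < e" .
  qed
qed

lemma inner_weighted_average:
  "weighted_average t X K \<bullet> y = weighted_average t (\<lambda>k. X k \<bullet> y) K"
  by (simp add: weighted_average_def inner_sum_left)

text \<open>
  Subtracting the partial sums of the errors from \<open>a\<close> leaves a decreasing sequence that is bounded below.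
\<close>

lemma quasi_fejer:
  fixes a u e :: "nat \<Rightarrow> real"
  assumes a: "\<And>n. 0 \<le> a n" and u: "\<And>n. 0 \<le> u n" and e: "\<And>n. 0 \<le> e n" "summable e"
    and step: "\<And>n. a (Suc n) + u n \<le> a n + e n"
  shows "convergent a" and "summable u"
proof -
  have total: "a n + (\<Sum>i<n. u i) \<le> a 0 + (\<Sum>i<n. e i)" for n
  proof (induction n)
    case (Suc n)
    then show ?case using step[of n] by simp
  qed simp
  have sume: "(\<Sum>i<n. e i) \<le> suminf e" for n
    using e by (intro sum_le_suminf) auto
  show "summable u"
  proof (rule summableI_nonneg_bounded[OF u])
    show "(\<Sum>i<n. u i) \<le> a 0 + suminf e" for n using total[of n] sume[of n] a[of n] by linarith
  qed
  define b where "b n = a n - (\<Sum>i<n. e i)" for n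
  have "decseq b"
    unfolding decseq_Suc_iff
  proof
    show "b (Suc n) \<le> b n" for n using step[of n] u[of n] by (simp add: b_def)
  qed
  moreover have "- suminf e \<le> b n" for n
    using a[of n] sume[of n] by (simp add: b_def)
  ultimately obtain L where "b \<longlonglongrightarrow> L"
    using decseq_convergent by metis
  moreover have "(\<lambda>n. \<Sum>i<n. e i) \<longlonglongrightarrow> suminf e" using e(2) by (rule summable_LIMSEQ)
  ultimately have "(\<lambda>n. b n + (\<Sum>i<n. e i)) \<longlonglongrightarrow> L + suminf e" by (rule tendsto_add)
  then show "convergent a" by (auto simp: b_def convergent_def)
qed

section \<open>One step of the optimistic extragradient method\<close>

text \<open>
  The proximal steps enter only through the variational inequalities of their values. The index
  of \<open>w\<close> is that of \<^const>\<open>optimistic_extragradient\<close>: \<open>w k\<close> is computed from \<open>z k\<close> and \<open>w (k - 1)\<close>.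
\<close>

locale extragradient_steps =
  fixes F1 F2 :: "'a::{real_inner, complete_space} \<Rightarrow> 'a"
    and f1 f2 :: "'a \<Rightarrow> real" and C1 C2 :: "'a set" and L1 L2 :: real
    and t \<sigma> :: "nat \<Rightarrow> real" and z w :: "nat \<Rightarrow> 'a"
  assumes mono1: "monotone_operator F1" and lip1: "L1-lipschitz_on UNIV F1"
    and mono2: "monotone_operator F2" and lip2: "L2-lipschitz_on UNIV F2"
    and lsc1: "convex_lsc C1 f1" and lsc2: "convex_lsc C2 f2" and C2_sub: "C2 \<subseteq> C1"
    and t_pos: "\<And>k. k \<ge> 1 \<Longrightarrow> t k > 0"
    and \<sigma>_pos: "\<And>k. k \<ge> 1 \<Longrightarrow> \<sigma> k > 0"
    and \<sigma>_decr: "\<And>k. k \<ge> 1 \<Longrightarrow> \<sigma> (Suc k) \<le> \<sigma> k"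
    and step_size: "\<And>k. k \<ge> 1 \<Longrightarrow> 4 * t k * (L2 + \<sigma> k * L1) \<le> 1"
    and start: "z 1 = w 0"
    and w_in: "\<And>k. k \<ge> 1 \<Longrightarrow> w k \<in> C2"
    and z_in: "\<And>k. k \<ge> 1 \<Longrightarrow> z (Suc k) \<in> C2"
    and w_step: "\<And>k y. k \<ge> 1 \<Longrightarrow> y \<in> C2 \<Longrightarrow>
        (z k - t k *\<^sub>R (F2 (w (k - 1)) + \<sigma> k *\<^sub>R F1 (w (k - 1))) - w k) \<bullet> (y - w k)
          \<le> t k * ((f2 y + \<sigma> k * f1 y) - (f2 (w k) + \<sigma> k * f1 (w k)))"
    and z_step: "\<And>k y. k \<ge> 1 \<Longrightarrow> y \<in> C2 \<Longrightarrow>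
        (z k - t k *\<^sub>R (F2 (w k) + \<sigma> k *\<^sub>R F1 (w k)) - z (Suc k)) \<bullet> (y - z (Suc k))
          \<le> t k * ((f2 y + \<sigma> k * f1 y) - (f2 (z (Suc k)) + \<sigma> k * f1 (z (Suc k))))"
begin

definition V :: "nat \<Rightarrow> 'a \<Rightarrow> 'a" where "V k x = F2 x + \<sigma> k *\<^sub>R F1 x"

definition G :: "nat \<Rightarrow> 'a \<Rightarrow> real" where "G k x = f2 x + \<sigma> k * f1 x"

definition energy :: "'a \<Rightarrow> nat \<Rightarrow> real" where
  "energy y k = (norm (z k - y))\<^sup>2 / 2 + (norm (z k - w (k - 1)))\<^sup>2 / 8"

lemma energy_nonneg: "0 \<le> energy y k"
  by (simp add: energy_def)

lemma \<sigma>_antimono: "1 \<le> m \<Longrightarrow> m \<le> n \<Longrightarrow> \<sigma> n \<le> \<sigma> m"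
proof (induction n)
  case (Suc n)
  then show ?case using \<sigma>_decr[of n] by (cases "m = Suc n") auto
qed simp

lemma L_nonneg: "0 \<le> L1" "0 \<le> L2"
  using lip1 lip2 lipschitz_on_nonneg by blast+

lemma continuous_F: "continuous_on UNIV F1" "continuous_on UNIV F2"
  using lip1 lip2 lipschitz_on_continuous_on by blast+

lemma V_lipschitz:
  assumes "k \<ge> 1"
  shows "norm (V k x - V k y) \<le> (L2 + \<sigma> k * L1) * norm (x - y)"
proof -
  have "norm (F1 x - F1 y) \<le> L1 * norm (x - y)" "norm (F2 x - F2 y) \<le> L2 * norm (x - y)"
    using lipschitz_onD[OF lip1, of x y] lipschitz_onD[OF lip2, of x y] by (simp_all add: dist_norm)
  moreover from this(1) have "\<sigma> k * norm (F1 x - F1 y) \<le> \<sigma> k * (L1 * norm (x - y))"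
    using \<sigma>_pos[OF assms] by simp
  moreover have "V k x - V k y = (F2 x - F2 y) + \<sigma> k *\<^sub>R (F1 x - F1 y)"
    by (simp add: V_def algebra_simps)
  then have "norm (V k x - V k y) \<le> norm (F2 x - F2 y) + \<sigma> k * norm (F1 x - F1 y)"
    using norm_triangle_ineq[of "F2 x - F2 y" "\<sigma> k *\<^sub>R (F1 x - F1 y)"] \<sigma>_pos[OF assms] by simp
  ultimately show ?thesis by (simp add: algebra_simps)
qed

text \<open>
  The two proximal inequalities, the first tested with \<open>z (Suc k)\<close> and the second with \<open>y\<close>, leave
  the error \<open>t (V (w k) - V (w (k - 1))) \<bullet> (w k - z (Suc k))\<close>. By the step size bound it is at most
  \<open>(a + b) * c / 4\<close> with \<open>a = \<parallel>w k - z k\<parallel>\<close>, \<open>b = \<parallel>z k - w (k - 1)\<parallel>\<close>, \<open>c = \<parallel>z (Suc k) - w k\<parallel>\<close>. The term in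
  \<open>b\<close> is the quantity \<open>c\<close> of the preceding step, which is why \<^const>\<open>energy\<close> contains it.
\<close>

lemma energy_step:
  assumes k: "k \<ge> 1" and y: "y \<in> C2"
  shows "energy y (Suc k) + (norm (z (Suc k) - w k))\<^sup>2 / 8 + 3 / 8 * (norm (w k - z k))\<^sup>2
      \<le> energy y k + t k * (gap F2 f2 y (w k) + \<sigma> k * gap F1 f1 y (w k))"
proof -
  define A B C D where "A = z k" and "B = w k" and "C = z (Suc k)" and "D = w (k - 1)"
  define a b c where "a = norm (B - A)" and "b = norm (A - D)" and "c = norm (C - B)"
  have 1: "(A - t k *\<^sub>R V k D - B) \<bullet> (C - B) \<le> t k * (G k C - G k B)"
    using w_step[OF k z_in[OF k]] by (simp add: A_def B_def C_def D_def V_def G_def)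
  have 2: "(A - t k *\<^sub>R V k B - C) \<bullet> (y - C) \<le> t k * (G k y - G k C)"
    using z_step[OF k y] by (simp add: A_def B_def C_def V_def G_def)
  have expand: "(A - t k *\<^sub>R V k D - B) \<bullet> (C - B) + (A - t k *\<^sub>R V k B - C) \<bullet> (y - C)
      = ((norm (C - y))\<^sup>2 - (norm (A - y))\<^sup>2 + a\<^sup>2 + c\<^sup>2) / 2
        - t k * (V k B \<bullet> (y - B)) - t k * ((V k D - V k B) \<bullet> (C - B))"
    unfolding a_def c_def power2_norm_eq_inner
    by (simp add: inner_diff_left inner_diff_right inner_add_left inner_add_right inner_commute field_simps)
  have gap: "gap F2 f2 y (w k) + \<sigma> k * gap F1 f1 y (w k) = V k B \<bullet> (y - B) + G k y - G k B"
    by (simp add: gap_def V_def G_def B_def inner_add_left algebra_simps)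
  have "(V k D - V k B) \<bullet> (C - B) \<le> norm (V k D - V k B) * c"
    unfolding c_def by (rule norm_cauchy_schwarz)
  also have "\<dots> \<le> ((L2 + \<sigma> k * L1) * norm (D - B)) * c"
    by (intro mult_right_mono V_lipschitz[OF k]) (simp add: c_def)
  finally have "t k * ((V k D - V k B) \<bullet> (C - B)) \<le> t k * (((L2 + \<sigma> k * L1) * norm (D - B)) * c)"
    using t_pos[OF k] by simp
  also have "\<dots> = (4 * t k * (L2 + \<sigma> k * L1)) * (norm (D - B) * c / 4)" by simp
  also have "\<dots> \<le> 1 * (norm (D - B) * c / 4)"
    by (rule mult_right_mono[OF step_size[OF k]]) (simp add: c_def)
  also have "norm (D - B) \<le> a + b"
    using norm_triangle_ineq[of "D - A" "A - B"] by (simp add: a_def b_def norm_minus_commute)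
  then have "1 * (norm (D - B) * c / 4) \<le> (a + b) * c / 4"
    by (simp add: c_def mult_right_mono)
  also have "(a + b) * c / 4 \<le> a\<^sup>2 / 8 + b\<^sup>2 / 8 + c\<^sup>2 / 4"
    using sum_squares_bound[of a c] sum_squares_bound[of b c]
    by (simp add: distrib_right)
  finally have err: "t k * ((V k D - V k B) \<bullet> (C - B)) \<le> a\<^sup>2 / 8 + b\<^sup>2 / 8 + c\<^sup>2 / 4" .
  have "((norm (C - y))\<^sup>2 - (norm (A - y))\<^sup>2 + a\<^sup>2 + c\<^sup>2) / 2
      - t k * (V k B \<bullet> (y - B)) - t k * ((V k D - V k B) \<bullet> (C - B))
    \<le> t k * (G k C - G k B) + t k * (G k y - G k C)"
    unfolding expand[symmetric] by (rule add_mono[OF 1 2])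
  then have "((norm (C - y))\<^sup>2 - (norm (A - y))\<^sup>2 + a\<^sup>2 + c\<^sup>2) / 2
    \<le> t k * (V k B \<bullet> (y - B) + G k y - G k B) + t k * ((V k D - V k B) \<bullet> (C - B))"
    by (simp add: algebra_simps)
  with err have "((norm (C - y))\<^sup>2 - (norm (A - y))\<^sup>2 + a\<^sup>2 + c\<^sup>2) / 2
    \<le> t k * (V k B \<bullet> (y - B) + G k y - G k B) + (a\<^sup>2 / 8 + b\<^sup>2 / 8 + c\<^sup>2 / 4)" by linarith
  then have "(norm (C - y))\<^sup>2 / 2 + c\<^sup>2 / 8 + c\<^sup>2 / 8 + 3 / 8 * a\<^sup>2
    \<le> (norm (A - y))\<^sup>2 / 2 + b\<^sup>2 / 8 + t k * (V k B \<bullet> (y - B) + G k y - G k B)" by argo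
  then show ?thesis
    unfolding gap energy_def
    by (simp add: A_def B_def C_def D_def a_def b_def c_def)
qed

end

section \<open>Convergence towards the solutions of the hierarchical problem\<close>

text \<open>
  \<open>S2\<close> and \<open>S1\<close> are the solution sets of the lower and of the hierarchical problem. The two last
  assumptions are the optimality of the points of \<open>S1\<close> and the summability hypothesis of
  Attouch-Czarnecki type, with the suprema over \<open>S2\<close> and over the domain written as bounds.
\<close>

locale hierarchical_extragradient = extragradient_steps +
  fixes S1 S2 :: "'a set"
  assumes S2_eq: "S2 = vi_solutions F2 f2 C2" and S1_eq: "S1 = vi_solutions F1 f1 S2"
    and S1_nonempty: "S1 \<noteq> {}"
    and T_lim: "filterlim (\<lambda>K. \<Sum>k=1..K. t k) at_top sequentially"
    and \<sigma>T_lim: "filterlim (\<lambda>K. \<sigma> K * (\<Sum>k=1..K. t k)) at_top sequentially"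
    and average_\<sigma>: "(\<lambda>K. (\<Sum>k=1..K. t k * \<sigma> k) / (\<Sum>k=1..K. t k)) \<longlonglongrightarrow> 0"
    and S1_optimality: "\<And>x. x \<in> S1 \<Longrightarrow> \<exists>p\<in>normal_cone S2 x. \<forall>y\<in>C1. gap F1 f1 x y \<le> p \<bullet> (y - x)"
    and summable_excess: "\<And>p v. p \<in> normal_cone S2 v \<Longrightarrow>
        \<exists>\<delta>. (\<forall>k\<ge>1. 0 \<le> \<delta> k) \<and> summable (\<lambda>k. t (Suc k) * \<delta> (Suc k)) \<and>
          (\<forall>k\<ge>1. \<forall>x\<in>S2. \<forall>y\<in>C2. gap F2 f2 x y + \<sigma> k * (p \<bullet> (y - v)) \<le> \<delta> k)"
begin

lemmas S2_minty = minty[OF convex_lsc_convex_on[OF lsc2] mono2 continuous_F(2), folded S2_eq]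

lemma S2_closed: "closed S2" and S2_convex: "convex S2"
  unfolding S2_eq by (rule vi_solutions_closed_convex[OF lsc2 mono2 continuous_F(2)])+

lemma S1_subset: "S1 \<subseteq> S2" and S2_subset: "S2 \<subseteq> C2"
  by (auto simp: S1_eq S2_eq vi_solutions_def)

lemma convex_f1_S2: "convex_on S2 f1"
  using convex_on_subset[OF convex_lsc_convex_on[OF lsc1] _ S2_convex] S2_subset C2_sub by simp

lemmas S1_minty = minty[OF convex_f1_S2 mono1 continuous_F(1), folded S1_eq]

lemma gap2_nonpos: "x \<in> S2 \<Longrightarrow> y \<in> C2 \<Longrightarrow> gap F2 f2 x y \<le> 0"
  by (simp add: S2_minty)

lemma weighted_gap_nonneg:
  assumes "x \<in> S2"
  shows "0 \<le> t (Suc n) * (- gap F2 f2 x (w (Suc n)))"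
  using gap2_nonpos[OF assms w_in[of "Suc n"]] t_pos[of "Suc n"]
  by (intro mult_nonneg_nonneg) simp_all

text \<open>
  For \<open>p\<close> the normal that certifies \<open>x \<in> S1\<close>, the upper level contributes at most
  \<open>\<sigma> k * (p \<bullet> (w k - x))\<close>. Splitting the lower-level gap into two halves and using the excess for
  \<open>2 * p\<close> absorbs this term and still leaves half of the gap on the left-hand side.
\<close>

lemma quasi_fejer_S1:
  assumes x: "x \<in> S1"
  shows "convergent (\<lambda>n. energy x (Suc n))"
    and "summable (\<lambda>n. (norm (z (Suc (Suc n)) - w (Suc n)))\<^sup>2 / 8 + 3 / 8 * (norm (w (Suc n) - z (Suc n)))\<^sup>2
            + t (Suc n) * (- gap F2 f2 x (w (Suc n))) / 2)"
proof -
  have xS2: "x \<in> S2" and xC2: "x \<in> C2" using x S1_subset S2_subset by auto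
  obtain p where p: "p \<in> normal_cone S2 x" "\<And>y. y \<in> C1 \<Longrightarrow> gap F1 f1 x y \<le> p \<bullet> (y - x)"
    using S1_optimality[OF x] by blast
  have "2 *\<^sub>R p \<in> normal_cone S2 x" using p(1) by (simp add: normal_cone_def)
  from summable_excess[OF this] obtain \<delta> where \<delta>: "\<And>k. k \<ge> 1 \<Longrightarrow> 0 \<le> \<delta> k"
      "summable (\<lambda>k. t (Suc k) * \<delta> (Suc k))"
      "\<And>k y. k \<ge> 1 \<Longrightarrow> y \<in> C2 \<Longrightarrow> gap F2 f2 x y + \<sigma> k * ((2 *\<^sub>R p) \<bullet> (y - x)) \<le> \<delta> k"
    using xS2 by blast
  define u where "u n = (norm (z (Suc (Suc n)) - w (Suc n)))\<^sup>2 / 8 + 3 / 8 * (norm (w (Suc n) - z (Suc n)))\<^sup>2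
            + t (Suc n) * (- gap F2 f2 x (w (Suc n))) / 2" for n
  have step: "energy x (Suc (Suc n)) + u n \<le> energy x (Suc n) + t (Suc n) * \<delta> (Suc n) / 2" for n
  proof -
    have w: "w (Suc n) \<in> C2" "w (Suc n) \<in> C1" using w_in[of "Suc n"] C2_sub by auto
    have "\<sigma> (Suc n) * gap F1 f1 x (w (Suc n)) \<le> \<sigma> (Suc n) * (p \<bullet> (w (Suc n) - x))"
      using p(2)[OF w(2)] \<sigma>_pos[of "Suc n"] by simp
    moreover have "gap F2 f2 x (w (Suc n)) + \<sigma> (Suc n) * (2 * (p \<bullet> (w (Suc n) - x))) \<le> \<delta> (Suc n)"
      using \<delta>(3)[OF _ w(1), of "Suc n"] by simp
    ultimately have "gap F2 f2 x (w (Suc n)) + \<sigma> (Suc n) * gap F1 f1 x (w (Suc n))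
        \<le> \<delta> (Suc n) / 2 + gap F2 f2 x (w (Suc n)) / 2"
      by argo
    then have "t (Suc n) * (gap F2 f2 x (w (Suc n)) + \<sigma> (Suc n) * gap F1 f1 x (w (Suc n)))
        \<le> t (Suc n) * (\<delta> (Suc n) / 2 + gap F2 f2 x (w (Suc n)) / 2)"
      using t_pos[of "Suc n"] by simp
    with energy_step[OF _ xC2, of "Suc n"] show ?thesis
      unfolding u_def by (simp add: algebra_simps)
  qed
  have u: "0 \<le> u n" for n
    unfolding u_def using weighted_gap_nonneg[OF xS2, of n] by (intro add_nonneg_nonneg) simp_all
  have e: "0 \<le> t (Suc n) * \<delta> (Suc n) / 2" for n
    using t_pos[of "Suc n"] \<delta>(1)[of "Suc n"] by simp
  have sum_e: "summable (\<lambda>n. t (Suc n) * \<delta> (Suc n) / 2)"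
    using \<delta>(2) by (rule summable_divide)
  note fejer = quasi_fejer[of "\<lambda>n. energy x (Suc n)", OF energy_nonneg u e sum_e step]
  show "convergent (\<lambda>n. energy x (Suc n))" by (rule fejer(1))
  show "summable (\<lambda>n. (norm (z (Suc (Suc n)) - w (Suc n)))\<^sup>2 / 8 + 3 / 8 * (norm (w (Suc n) - z (Suc n)))\<^sup>2
            + t (Suc n) * (- gap F2 f2 x (w (Suc n))) / 2)"
    using fejer(2) by (simp only: u_def)
qed

lemma summable_gap:
  assumes x: "x \<in> S1"
  shows "summable (\<lambda>n. t (Suc n) * (- gap F2 f2 x (w (Suc n))))"
proof -
  have nonneg: "0 \<le> t (Suc n) * (- gap F2 f2 x (w (Suc n)))" for n
    using weighted_gap_nonneg x S1_subset by blast
  have "summable (\<lambda>n. t (Suc n) * (- gap F2 f2 x (w (Suc n))) / 2)"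
    by (rule summable_comparison_test'[OF quasi_fejer_S1(2)[OF x], of 0])
       (use nonneg in \<open>simp add: abs_of_nonneg\<close>)
  from summable_mult[OF this, of 2] show ?thesis by simp
qed

lemma steps_vanish:
  shows "(\<lambda>n. z (Suc n) - w (Suc n)) \<longlonglongrightarrow> 0" and "(\<lambda>n. z (Suc n) - w n) \<longlonglongrightarrow> 0"
proof -
  obtain x where x: "x \<in> S1" using S1_nonempty by blast
  define u where "u n = (norm (z (Suc (Suc n)) - w (Suc n)))\<^sup>2 / 8 + 3 / 8 * (norm (w (Suc n) - z (Suc n)))\<^sup>2
            + t (Suc n) * (- gap F2 f2 x (w (Suc n))) / 2" for n
  have u: "(\<lambda>n. 8 * u n) \<longlonglongrightarrow> 0"
    using tendsto_mult_left[OF summable_LIMSEQ_zero[OF quasi_fejer_S1(2)[OF x]], of 8]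
    unfolding u_def by simp
  have nonneg: "0 \<le> t (Suc n) * (- gap F2 f2 x (w (Suc n)))" for n
    using weighted_gap_nonneg x S1_subset by blast
  have null: "v \<longlonglongrightarrow> 0" if "\<And>n. (norm (v n))\<^sup>2 \<le> 8 * u n" for v :: "nat \<Rightarrow> 'a"
  proof -
    have "(\<lambda>n. (norm (v n))\<^sup>2) \<longlonglongrightarrow> 0"
      by (rule tendsto_sandwich[OF _ _ tendsto_const u]) (use that in auto)
    from tendsto_real_sqrt[OF this] show ?thesis by (simp add: tendsto_norm_zero_iff)
  qed
  show "(\<lambda>n. z (Suc n) - w (Suc n)) \<longlonglongrightarrow> 0"
  proof (rule null)
    fix n
    have "0 \<le> (norm (z (Suc (Suc n)) - w (Suc n)))\<^sup>2" "0 \<le> (norm (w (Suc n) - z (Suc n)))\<^sup>2" by simp_all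
    then show "(norm (z (Suc n) - w (Suc n)))\<^sup>2 \<le> 8 * u n"
      unfolding u_def norm_minus_commute[of "z (Suc n)"] using nonneg[of n] by argo
  qed
  have "(\<lambda>n. z (Suc (Suc n)) - w (Suc n)) \<longlonglongrightarrow> 0"
  proof (rule null)
    fix n
    have "0 \<le> (norm (w (Suc n) - z (Suc n)))\<^sup>2" by simp
    then show "(norm (z (Suc (Suc n)) - w (Suc n)))\<^sup>2 \<le> 8 * u n"
      unfolding u_def using nonneg[of n] by argo
  qed
  then show "(\<lambda>n. z (Suc n) - w n) \<longlonglongrightarrow> 0"
    by (simp only: filterlim_sequentially_Suc[of "\<lambda>n. z (Suc n) - w n"])
qed

lemma convergent_distance:
  assumes x: "x \<in> S1"
  shows "convergent (\<lambda>n. (norm (z (Suc n) - x))\<^sup>2)"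
proof -
  obtain l where l: "(\<lambda>n. energy x (Suc n)) \<longlonglongrightarrow> l"
    using quasi_fejer_S1(1)[OF x] by (auto simp: convergent_def)
  have b: "(\<lambda>n. (norm (z (Suc n) - w n))\<^sup>2 / 4) \<longlonglongrightarrow> 0"
    using tendsto_divide[OF tendsto_power[OF tendsto_norm[OF steps_vanish(2)], of 2] tendsto_const[of 4]]
    by simp
  have "(\<lambda>n. 2 * energy x (Suc n) - (norm (z (Suc n) - w n))\<^sup>2 / 4) \<longlonglongrightarrow> 2 * l - 0"
    by (intro tendsto_diff tendsto_mult tendsto_const l b)
  moreover have "2 * energy x (Suc n) - (norm (z (Suc n) - w n))\<^sup>2 / 4 = (norm (z (Suc n) - x))\<^sup>2" for n
    by (simp add: energy_def)
  ultimately show ?thesis by (auto simp: convergent_def)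
qed

lemma iterates_bounded:
  obtains B where "0 \<le> B" "\<And>k. k \<ge> 1 \<Longrightarrow> norm (z k) \<le> B" "\<And>k. k \<ge> 1 \<Longrightarrow> norm (w k) \<le> B"
proof -
  obtain x where x: "x \<in> S1" using S1_nonempty by blast
  obtain b where b: "\<And>n. norm ((norm (z (Suc n) - x))\<^sup>2) \<le> b"
    using convergent_imp_Bseq[OF convergent_distance[OF x]] unfolding Bseq_def by blast
  obtain c where c: "\<And>n. norm (z (Suc n) - w (Suc n)) \<le> c"
    using convergent_imp_Bseq[OF convergentI[OF steps_vanish(1)]] unfolding Bseq_def by blast
  have z: "norm (z (Suc n)) \<le> norm x + sqrt b" for n
  proof -
    have "norm (z (Suc n) - x) \<le> sqrt b" using b[of n] by (intro real_le_rsqrt) simp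
    then show ?thesis using norm_triangle_sub[of "z (Suc n)" x] by linarith
  qed
  have w: "norm (w (Suc n)) \<le> norm x + sqrt b + c" for n
    using z[of n] c[of n] norm_triangle_sub[of "w (Suc n)" "z (Suc n)"]
    by (simp add: norm_minus_commute)
  have c0: "0 \<le> c" using c[of 0] norm_ge_zero order_trans by blast
  show ?thesis
  proof (rule that[of "norm x + sqrt b + c"])
    show "0 \<le> norm x + sqrt b + c" using w[of 0] norm_ge_zero order_trans by blast
    fix k :: nat assume "k \<ge> 1"
    then obtain n where n: "k = Suc n" by (cases k) auto
    show "norm (z k) \<le> norm x + sqrt b + c" unfolding n using z[of n] c0 by linarith
    show "norm (w k) \<le> norm x + sqrt b + c" unfolding n by (rule w)
  qed
qed

lemma F_bounded:
  assumes "L-lipschitz_on UNIV F" "norm x \<le> B"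
  shows "norm (F x) \<le> norm (F (0::'a) :: 'a) + L * B"
proof -
  have "norm (F x - F 0) \<le> L * norm x"
    using lipschitz_onD[OF assms(1), of x 0] by (simp add: dist_norm)
  also have "\<dots> \<le> L * B" using assms lipschitz_on_nonneg by (intro mult_left_mono) auto
  finally show ?thesis using norm_triangle_sub[of "F x" "F 0"] by linarith
qed

lemma V_bounded:
  obtains c where "0 \<le> c" "\<And>k. k \<ge> 1 \<Longrightarrow> norm (V k (w k)) \<le> c"
proof -
  obtain B where B: "0 \<le> B" "\<And>k. k \<ge> 1 \<Longrightarrow> norm (w k) \<le> B" using iterates_bounded by metis
  define b1 b2 where "b1 = norm (F1 0) + L1 * B" and "b2 = norm (F2 0) + L2 * B"
  have b: "0 \<le> b1" "0 \<le> b2" using L_nonneg B(1) by (auto simp: b1_def b2_def)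
  show ?thesis
  proof (rule that[of "b2 + \<sigma> 1 * b1"])
    show "0 \<le> b2 + \<sigma> 1 * b1" using b \<sigma>_pos[of 1] by simp
    fix k :: nat assume k: "k \<ge> 1"
    have "norm (V k (w k)) \<le> norm (F2 (w k)) + \<sigma> k * norm (F1 (w k))"
      unfolding V_def using norm_triangle_ineq[of "F2 (w k)" "\<sigma> k *\<^sub>R F1 (w k)"] \<sigma>_pos[OF k] by simp
    also have "\<dots> \<le> b2 + \<sigma> 1 * b1"
    proof (rule add_mono)
      show "norm (F2 (w k)) \<le> b2" unfolding b2_def by (rule F_bounded[OF lip2 B(2)[OF k]])
      show "\<sigma> k * norm (F1 (w k)) \<le> \<sigma> 1 * b1"
        using F_bounded[OF lip1 B(2)[OF k]] \<sigma>_antimono[of 1 k] k \<sigma>_pos[of 1]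
        by (intro mult_mono) (auto simp: b1_def)
    qed
    finally show "norm (V k (w k)) \<le> b2 + \<sigma> 1 * b1" .
  qed
qed

section \<open>Weak accumulation points of the iterates\<close>

text \<open>
  Write \<open>\<gamma> k = G k (z k)\<close>. One proximal inequality, tested with \<open>z k\<close>, shows that \<open>\<gamma>\<close> grows by at most
  a constant times \<open>t k\<close>; the other, tested with a fixed point, shows that \<open>\<parallel>z k - x\<parallel>\<^sup>2 / 2\<close> shrinks by
  at least as much whenever \<open>G k (z (Suc k))\<close> is large. Hence the sum of the two cannot grow beyond a
  fixed bound. As \<open>\<sigma>\<close> decreases and \<open>f1\<close> is bounded below along the iterates, the passage from
  \<open>G k\<close> to \<open>G (Suc k)\<close> costs at most a multiple of \<open>\<sigma> k - \<sigma> (Suc k)\<close>; the summand \<open>c * \<sigma> k\<close> of \<open>P\<close> below pays for it.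
\<close>

lemma objective_bounded:
  obtains M where "\<And>k. k \<ge> 2 \<Longrightarrow> G k (z k) \<le> M"
proof -
  obtain x where x: "x \<in> C2" using S1_nonempty S1_subset S2_subset by blast
  obtain B where B: "0 \<le> B" "\<And>k. k \<ge> 1 \<Longrightarrow> norm (z k) \<le> B" using iterates_bounded by metis
  obtain v where v: "0 \<le> v" "\<And>k. k \<ge> 1 \<Longrightarrow> norm (V k (w k)) \<le> v" using V_bounded by metis
  obtain m where m: "\<And>y. y \<in> C1 \<Longrightarrow> norm y \<le> B \<Longrightarrow> m \<le> f1 y"
    using convex_lsc_bounded_below[OF lsc1, of B] by blast
  define c where "c = \<bar>m\<bar>"
  have f1_low: "- c \<le> f1 (z (Suc k))" if "k \<ge> 1" for k
    using m[of "z (Suc k)"] z_in[OF that] C2_sub B(2)[of "Suc k"] by (auto simp: c_def)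
  define P where "P k = G k (z k) + (norm (z k - x))\<^sup>2 / 2 + c * \<sigma> k" for k
  define R where "R = (B + norm x)\<^sup>2 / 2"
  define A where "A = v * (B + norm x) + \<bar>f2 x\<bar> + \<sigma> 1 * \<bar>f1 x\<bar>"
  have dist_le: "norm (z k - x) \<le> B + norm x" if "k \<ge> 1" for k
    using norm_triangle_ineq4[of "z k" x] B(2)[OF that] by linarith
  have R_le: "(norm (z k - x))\<^sup>2 / 2 \<le> R" if "k \<ge> 1" for k
    unfolding R_def using dist_le[OF that] by (simp add: power_mono)
  \<comment> \<open>\<open>z 1\<close> need not lie in the domain, so the induction starts at \<open>2\<close>; the second bound is the value
    that \<open>P\<close> can reach after a step to a point with a small objective value\<close>
  define M where "M = max (P 2) (A + v\<^sup>2 / 4 + c * \<sigma> 1 + R)"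
  have "P k \<le> M" if "k \<ge> 2" for k
    using that
  proof (induction k rule: dec_induct)
    case (step k)
    then have k: "k \<ge> 1" "k - 1 \<ge> 1" "Suc (k - 1) = k" by auto
    have zk: "z k \<in> C2" using z_in[OF k(2)] k(3) by simp
    have t: "t k > 0" by (rule t_pos[OF k(1)])
    define d where "d = norm (z k - z (Suc k))"
    have "(z k - t k *\<^sub>R V k (w k) - z (Suc k)) \<bullet> (z k - z (Suc k)) \<le> t k * (G k (z k) - G k (z (Suc k)))"
      using z_step[OF k(1) zk] by (simp add: V_def G_def)
    moreover have "(z k - t k *\<^sub>R V k (w k) - z (Suc k)) \<bullet> (z k - z (Suc k))
        = d\<^sup>2 - t k * (V k (w k) \<bullet> (z k - z (Suc k)))"
      by (simp add: d_def power2_norm_eq_inner inner_diff_left)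
    moreover have "t k * (V k (w k) \<bullet> (z k - z (Suc k))) \<le> t k * (v * d)"
    proof (rule mult_left_mono)
      show "V k (w k) \<bullet> (z k - z (Suc k)) \<le> v * d"
        using norm_cauchy_schwarz[of "V k (w k)" "z k - z (Suc k)"]
          mult_right_mono[OF v(2)[OF k(1)], of d] unfolding d_def by simp
    qed (use t in simp)
    moreover have "t k * (v * d) \<le> d\<^sup>2 + (t k)\<^sup>2 * v\<^sup>2 / 4"
      using zero_le_power2[of "d - t k * v / 2"] by (simp add: power2_eq_square algebra_simps)
    ultimately have "- ((t k)\<^sup>2 * v\<^sup>2 / 4) \<le> t k * (G k (z k) - G k (z (Suc k)))" by linarith
    then have "t k * (G k (z (Suc k)) - G k (z k)) \<le> t k * (t k * v\<^sup>2 / 4)"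
      by (simp add: algebra_simps power2_eq_square)
    then have slow: "G k (z (Suc k)) \<le> G k (z k) + t k * v\<^sup>2 / 4"
      using t by simp
    have "(z k - t k *\<^sub>R V k (w k) - z (Suc k)) \<bullet> (x - z (Suc k)) \<le> t k * (G k x - G k (z (Suc k)))"
      using z_step[OF k(1) x] by (simp add: V_def G_def)
    moreover have "(z k - t k *\<^sub>R V k (w k) - z (Suc k)) \<bullet> (x - z (Suc k))
        = ((norm (z (Suc k) - x))\<^sup>2 - (norm (z k - x))\<^sup>2 + d\<^sup>2) / 2 - t k * (V k (w k) \<bullet> (x - z (Suc k)))"
      unfolding d_def power2_norm_eq_inner
      by (simp add: inner_diff_left inner_diff_right inner_add_left inner_add_right inner_commute field_simps)
    moreover have "t k * (G k x + V k (w k) \<bullet> (x - z (Suc k))) \<le> t k * A"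
    proof (rule mult_left_mono)
      have "V k (w k) \<bullet> (x - z (Suc k)) \<le> norm (V k (w k)) * norm (x - z (Suc k))"
        by (rule norm_cauchy_schwarz)
      also have "\<dots> \<le> v * (B + norm x)"
        using v(1) v(2)[OF k(1)] dist_le[of "Suc k"] by (intro mult_mono) (simp_all add: norm_minus_commute)
      finally have "V k (w k) \<bullet> (x - z (Suc k)) \<le> v * (B + norm x)" .
      moreover have "\<sigma> k * f1 x \<le> \<sigma> 1 * \<bar>f1 x\<bar>"
        by (rule order_trans[OF mult_left_mono[OF abs_ge_self] mult_right_mono])
           (use \<sigma>_antimono[OF order_refl k(1)] \<sigma>_pos[OF k(1)] in auto)
      ultimately show "G k x + V k (w k) \<bullet> (x - z (Suc k)) \<le> A"
        unfolding G_def A_def by linarith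
    qed (use t in simp)
    moreover have "0 \<le> d\<^sup>2" by simp
    ultimately have dissipation:
      "(norm (z (Suc k) - x))\<^sup>2 / 2 \<le> (norm (z k - x))\<^sup>2 / 2 + t k * (A - G k (z (Suc k)))"
      unfolding distrib_left right_diff_distrib by argo
    have "(\<sigma> k - \<sigma> (Suc k)) * - c \<le> (\<sigma> k - \<sigma> (Suc k)) * f1 (z (Suc k))"
      using f1_low[OF k(1)] \<sigma>_decr[OF k(1)] by (intro mult_left_mono) auto
    then have change: "G (Suc k) (z (Suc k)) + c * \<sigma> (Suc k) \<le> G k (z (Suc k)) + c * \<sigma> k"
      by (simp add: G_def algebra_simps)
    \<comment> \<open>at the threshold the decrease of the distance balances the growth \<open>t k * v\<^sup>2 / 4\<close> of the objective\<close>
    show ?case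
    proof (cases "A + v\<^sup>2 / 4 \<le> G k (z (Suc k))")
      case True
      then have "t k * (A - G k (z (Suc k))) \<le> t k * (- (v\<^sup>2 / 4))"
        using t by (intro mult_left_mono) auto
      then have "P (Suc k) \<le> P k"
        using slow dissipation change unfolding P_def by simp
      then show ?thesis using step by linarith
    next
      case False
      have "c * \<sigma> k \<le> c * \<sigma> 1"
        using \<sigma>_antimono[OF order_refl k(1)] by (simp add: c_def mult_left_mono)
      then have "P (Suc k) \<le> A + v\<^sup>2 / 4 + c * \<sigma> 1 + R"
        using False change R_le[of "Suc k"] unfolding P_def by simp
      then show ?thesis unfolding M_def by simp
    qed
  qed (simp add: M_def)
  moreover have "G k (z k) \<le> P k" if "k \<ge> 2" for k
    using \<sigma>_pos[of k] that unfolding P_def c_def by simp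
  ultimately have "G k (z k) \<le> M" if "k \<ge> 2" for k using that by (meson order_trans)
  then show ?thesis by (rule that)
qed

text \<open>
  Since the objective values at \<open>z m\<close> are bounded, \<open>z m\<close> may serve as the test point of the later
  steps. Thus \<open>z\<close> is Hoelder continuous with exponent one half in the elapsed time \<open>\<Sum>t\<close>.
\<close>

lemma iterates_equicontinuous:
  obtains D where "D > 0" "\<And>m n. 2 \<le> m \<Longrightarrow> m \<le> n \<Longrightarrow> (norm (z n - z m))\<^sup>2 \<le> D * (\<Sum>k=m..<n. t k)"
proof -
  obtain B where B: "0 \<le> B" "\<And>k. k \<ge> 1 \<Longrightarrow> norm (z k) \<le> B" using iterates_bounded by metis
  obtain v where v: "0 \<le> v" "\<And>k. k \<ge> 1 \<Longrightarrow> norm (V k (w k)) \<le> v" using V_bounded by metis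
  obtain M where M: "\<And>k. k \<ge> 2 \<Longrightarrow> G k (z k) \<le> M" using objective_bounded by metis
  obtain m1 where m1: "\<And>y. y \<in> C1 \<Longrightarrow> norm y \<le> B \<Longrightarrow> m1 \<le> f1 y"
    using convex_lsc_bounded_below[OF lsc1, of B] by blast
  obtain m2 where m2: "\<And>y. y \<in> C2 \<Longrightarrow> norm y \<le> B \<Longrightarrow> m2 \<le> f2 y"
    using convex_lsc_bounded_below[OF lsc2, of B] by blast
  define c where "c = \<bar>m1\<bar>"
  have f1_low: "- c \<le> f1 (z (Suc k))" if "k \<ge> 1" for k
    using m1[of "z (Suc k)"] z_in[OF that] C2_sub B(2)[of "Suc k"] by (auto simp: c_def)
  have \<sigma>1: "\<sigma> k * a \<le> \<sigma> 1 * a" if "k \<ge> 1" "0 \<le> a" for k a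
    using \<sigma>_antimono[OF order_refl that(1)] that(2) by (rule mult_right_mono)
  define A where "A = v * (2 * B) + M + \<sigma> 1 * c - m2 + \<sigma> 1 * c"
  have key: "(norm (z n - z m))\<^sup>2 / 2 \<le> A * (\<Sum>k=m..<n. t k)" if m: "2 \<le> m" and n: "m \<le> n" for m n
    using n
  proof (induction n rule: dec_induct)
    case (step k)
    then have k: "k \<ge> 1" using m by simp
    obtain i where i: "m = Suc i" "i \<ge> 1" using m by (cases m) auto
    have zm: "z m \<in> C2" using z_in[OF i(2)] i(1) by simp
    have "(z k - t k *\<^sub>R V k (w k) - z (Suc k)) \<bullet> (z m - z (Suc k)) \<le> t k * (G k (z m) - G k (z (Suc k)))"
      using z_step[OF k zm] by (simp add: V_def G_def)
    moreover have "(z k - t k *\<^sub>R V k (w k) - z (Suc k)) \<bullet> (z m - z (Suc k))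
        = ((norm (z (Suc k) - z m))\<^sup>2 - (norm (z k - z m))\<^sup>2 + (norm (z k - z (Suc k)))\<^sup>2) / 2
          - t k * (V k (w k) \<bullet> (z m - z (Suc k)))"
      unfolding power2_norm_eq_inner
      by (simp add: inner_diff_left inner_diff_right inner_add_left inner_add_right inner_commute field_simps)
    moreover have "t k * (V k (w k) \<bullet> (z m - z (Suc k)) + G k (z m) - G k (z (Suc k))) \<le> t k * A"
    proof (rule mult_left_mono)
      have "V k (w k) \<bullet> (z m - z (Suc k)) \<le> norm (V k (w k)) * norm (z m - z (Suc k))"
        by (rule norm_cauchy_schwarz)
      also have "\<dots> \<le> v * (2 * B)"
        using v(1) v(2)[OF k] B(2)[of m] B(2)[of "Suc k"] m norm_triangle_ineq4[of "z m" "z (Suc k)"]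
        by (intro mult_mono) auto
      finally have 1: "V k (w k) \<bullet> (z m - z (Suc k)) \<le> v * (2 * B)" .
      have "(\<sigma> m - \<sigma> k) * - c \<le> (\<sigma> m - \<sigma> k) * f1 (z m)"
        using f1_low[OF i(2)] i(1) \<sigma>_antimono[of m k] m step(1) by (intro mult_left_mono) auto
      then have "G k (z m) \<le> G m (z m) + (\<sigma> m - \<sigma> k) * c" by (simp add: G_def algebra_simps)
      moreover have "0 \<le> \<sigma> k * c" "\<sigma> m * c \<le> \<sigma> 1 * c"
        using \<sigma>_pos[OF k] \<sigma>1[of m c] m by (simp_all add: c_def)
      moreover have "G m (z m) \<le> M" by (rule M[OF m])
      ultimately have 2: "G k (z m) \<le> M + \<sigma> 1 * c" by (simp add: algebra_simps)
      have "\<sigma> k * - c \<le> \<sigma> k * f1 (z (Suc k))"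
        using f1_low[OF k] \<sigma>_pos[OF k] by (intro mult_left_mono) auto
      moreover have "m2 \<le> f2 (z (Suc k))" using m2[OF z_in[OF k]] B(2)[of "Suc k"] by simp
      ultimately have 3: "m2 - \<sigma> 1 * c \<le> G k (z (Suc k))"
        using \<sigma>1[OF k, of c] by (simp add: G_def c_def)
      show "V k (w k) \<bullet> (z m - z (Suc k)) + G k (z m) - G k (z (Suc k)) \<le> A"
        using 1 2 3 unfolding A_def by linarith
    qed (use t_pos[OF k] in simp)
    moreover have "0 \<le> (norm (z k - z (Suc k)))\<^sup>2" by simp
    ultimately have "(norm (z (Suc k) - z m))\<^sup>2 / 2 \<le> (norm (z k - z m))\<^sup>2 / 2 + t k * A"
      unfolding distrib_left right_diff_distrib by argo
    also have "\<dots> \<le> A * (\<Sum>k=m..<k. t k) + t k * A" using step by simp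
    also have "\<dots> = A * (\<Sum>k=m..<Suc k. t k)"
      using step(1) by (simp add: algebra_simps)
    finally show ?case .
  qed simp
  show ?thesis
  proof (rule that[of "2 * \<bar>A\<bar> + 1"])
    fix m n :: nat assume mn: "2 \<le> m" "m \<le> n"
    have "0 \<le> (\<Sum>k=m..<n. t k)" using t_pos mn by (intro sum_nonneg) (auto simp: less_imp_le)
    then have "2 * A * (\<Sum>k=m..<n. t k) \<le> (2 * \<bar>A\<bar> + 1) * (\<Sum>k=m..<n. t k)"
      by (intro mult_right_mono) auto
    with key[OF mn] show "(norm (z n - z m))\<^sup>2 \<le> (2 * \<bar>A\<bar> + 1) * (\<Sum>k=m..<n. t k)" by linarith
  qed simp
qed

lemma sum_t_\<sigma>_unbounded: "\<not> summable (\<lambda>n. t (Suc n) * \<sigma> (Suc n))"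
proof
  assume s: "summable (\<lambda>n. t (Suc n) * \<sigma> (Suc n))"
  obtain K where K: "suminf (\<lambda>n. t (Suc n) * \<sigma> (Suc n)) + 1 \<le> \<sigma> K * (\<Sum>k=1..K. t k)" "K \<ge> 1"
    using eventually_happens'[OF sequentially_bot eventually_conj[OF
        \<sigma>T_lim[unfolded filterlim_at_top, rule_format] eventually_ge_at_top[of 1]]] by blast
  have "\<sigma> K * (\<Sum>k=1..K. t k) \<le> (\<Sum>k=1..K. t k * \<sigma> k)"
    unfolding sum_distrib_left
  proof (rule sum_mono)
    fix k assume "k \<in> {1..K}"
    then show "\<sigma> K * t k \<le> t k * \<sigma> k"
      using \<sigma>_antimono[of k K] t_pos[of k] by (simp add: mult.commute mult_left_mono)
  qed
  also have "\<dots> = (\<Sum>n<K. t (Suc n) * \<sigma> (Suc n))"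
    by (simp add: sum.shift_bounds_cl_Suc_ivl sum.atLeast1_atMost_eq)
  also have "\<dots> \<le> suminf (\<lambda>n. t (Suc n) * \<sigma> (Suc n))"
    by (rule sum_le_suminf[OF s]) (use t_pos \<sigma>_pos in \<open>auto simp: less_imp_le\<close>)
  finally show False using K by linarith
qed

text \<open>
  The excess bound \<open>\<delta>\<close> for the normal \<open>p\<close> at \<open>v\<close> holds for all members \<open>x\<close> of \<open>S2\<close> at once. Since
  \<open>\<Sum>t \<delta>\<close> converges and \<open>\<Sum>t \<sigma>\<close> diverges, \<open>\<delta> j < \<sigma> j * s\<close> for some index \<open>j\<close>. So the gap at every \<open>x\<close>
  is negative, uniformly on the points of the domain in the half-space \<open>s \<le> p \<bullet> (y - v)\<close>.
\<close>

lemma gap_uniformly_negative: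
  assumes p: "p \<in> normal_cone S2 v" and s: "s > 0"
  obtains e where "e > 0"
    "\<And>x y. x \<in> S2 \<Longrightarrow> y \<in> C2 \<Longrightarrow> s \<le> p \<bullet> (y - v) \<Longrightarrow> gap F2 f2 x y \<le> - e"
proof -
  from summable_excess[OF p] obtain \<delta> where \<delta>: "summable (\<lambda>k. t (Suc k) * \<delta> (Suc k))"
      "\<And>k x y. k \<ge> 1 \<Longrightarrow> x \<in> S2 \<Longrightarrow> y \<in> C2 \<Longrightarrow> gap F2 f2 x y + \<sigma> k * (p \<bullet> (y - v)) \<le> \<delta> k"
    by blast
  have "\<exists>j\<ge>1. \<delta> j < \<sigma> j * s"
  proof (rule ccontr)
    assume "\<not> ?thesis"
    then have no: "\<sigma> (Suc n) * s \<le> \<delta> (Suc n)" for n by (auto simp: not_less)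
    have "summable (\<lambda>n. s * (t (Suc n) * \<sigma> (Suc n)))"
    proof (rule summable_comparison_test'[OF \<delta>(1), of 0])
      fix n
      have "t (Suc n) * (\<sigma> (Suc n) * s) \<le> t (Suc n) * \<delta> (Suc n)"
        using no[of n] t_pos[of "Suc n"] by (intro mult_left_mono) auto
      moreover have "0 \<le> s * (t (Suc n) * \<sigma> (Suc n))"
        using s t_pos[of "Suc n"] \<sigma>_pos[of "Suc n"] by simp
      ultimately show "norm (s * (t (Suc n) * \<sigma> (Suc n))) \<le> t (Suc n) * \<delta> (Suc n)"
        by (simp add: mult_ac)
    qed
    then have "summable (\<lambda>n. t (Suc n) * \<sigma> (Suc n))"
      using s by (simp add: summable_cmult_iff)
    with sum_t_\<sigma>_unbounded show False by simp
  qed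
  then obtain j where j: "j \<ge> 1" "\<delta> j < \<sigma> j * s" by blast
  show ?thesis
  proof (rule that[of "\<sigma> j * s - \<delta> j"])
    fix x y assume xy: "x \<in> S2" "y \<in> C2" "s \<le> p \<bullet> (y - v)"
    have "\<sigma> j * s \<le> \<sigma> j * (p \<bullet> (y - v))" using xy(3) \<sigma>_pos[OF j(1)] by simp
    with \<delta>(2)[OF j(1) xy(1,2)] show "gap F2 f2 x y \<le> - (\<sigma> j * s - \<delta> j)" by linarith
  qed (use j in simp)
qed

text \<open>
  Suppose that the accumulation point \<open>x\<close> is not in \<open>S2\<close>, let \<open>v\<close> be its nearest point in \<open>S2\<close> and
  \<open>p = x - v\<close>. The iterates enter the half-space \<open>p \<bullet> (y - v) \<ge> 7/8 \<parallel>p\<parallel>\<^sup>2\<close> infinitely often. By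
  equicontinuity each time they stay in \<open>p \<bullet> (y - v) \<ge> \<parallel>p\<parallel>\<^sup>2 / 2\<close> for at least the time \<open>\<tau>\<close>. There the gap
  is at most \<open>- e\<close>, so every visit costs \<open>e * \<tau>\<close>, in contradiction to the summability of the gaps.
\<close>

lemma weak_accumulation_points_in_S2:
  assumes x: "weak_accumulation_point (\<lambda>k. w (Suc k)) x"
  shows "x \<in> S2"
proof (rule ccontr)
  assume xS2: "x \<notin> S2"
  obtain x0 where x0: "x0 \<in> S1" "x0 \<in> S2" using S1_nonempty S1_subset by blast
  obtain v where v: "v \<in> S2" "\<And>y. y \<in> S2 \<Longrightarrow> (x - v) \<bullet> (y - v) \<le> 0"
    using nearest_point_exists[OF S2_convex S2_closed, of x] x0(2) by blast
  define p where "p = x - v"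
  define d where "d = (norm p)\<^sup>2"
  have d: "d > 0" using xS2 v(1) by (auto simp: d_def p_def)
  have p: "p \<in> normal_cone S2 v" using v by (simp add: normal_cone_def p_def)
  obtain e where e: "e > 0" "\<And>y. y \<in> C2 \<Longrightarrow> d / 2 \<le> p \<bullet> (y - v) \<Longrightarrow> gap F2 f2 x0 y \<le> - e"
    using gap_uniformly_negative[OF p, of "d / 2"] d x0(2) by (metis half_gt_zero)
  obtain D where D: "D > 0"
    "\<And>m n. 2 \<le> m \<Longrightarrow> m \<le> n \<Longrightarrow> (norm (z n - z m))\<^sup>2 \<le> D * (\<Sum>k=m..<n. t k)"
    using iterates_equicontinuous by metis
  \<comment> \<open>within the time \<open>\<tau>\<close> the iterates move by at most \<open>\<parallel>p\<parallel> / 8\<close>\<close>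
  define \<tau> where "\<tau> = d / (64 * D)"
  have \<tau>: "\<tau> > 0" "D * \<tau> = d / 64" using d D(1) by (simp_all add: \<tau>_def)
  \<comment> \<open>far out, \<open>z k\<close> and \<open>w k\<close> are indistinguishable for \<open>p\<close>\<close>
  have "(\<lambda>n. p \<bullet> (z (Suc n) - w (Suc n))) \<longlonglongrightarrow> p \<bullet> 0"
    by (intro tendsto_inner tendsto_const steps_vanish(1))
  then have "eventually (\<lambda>n. \<bar>p \<bullet> (z (Suc n) - w (Suc n))\<bar> < d / 8) sequentially"
    using tendstoD[of "\<lambda>n. p \<bullet> (z (Suc n) - w (Suc n))" 0 sequentially "d / 8"] d by (simp add: dist_real_def)
  then obtain N1 where N1: "\<And>n. n \<ge> N1 \<Longrightarrow> \<bar>p \<bullet> (z (Suc n) - w (Suc n))\<bar> < d / 8"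
    by (auto simp: eventually_sequentially)
  have "e * \<tau> > 0" using e(1) \<tau>(1) by simp
  then obtain N2 where N2: "\<And>m n. m \<ge> N2 \<Longrightarrow>
      norm (\<Sum>k=m..<n. t (Suc k) * (- gap F2 f2 x0 (w (Suc k)))) < e * \<tau>"
    using summable_gap[OF x0(1)] unfolding summable_Cauchy by blast
  obtain r where r: "strict_mono r" "weakly_converges ((\<lambda>k. w (Suc k)) \<circ> r) x"
    using x unfolding weak_accumulation_point_def by blast
  have "(\<lambda>n. w (Suc (r n)) \<bullet> p) \<longlonglongrightarrow> x \<bullet> p"
    using r(2) by (simp add: weakly_converges_def o_def)
  then have "(\<lambda>n. w (Suc (r n)) \<bullet> p - v \<bullet> p) \<longlonglongrightarrow> x \<bullet> p - v \<bullet> p"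
    by (intro tendsto_diff tendsto_const)
  moreover have "x \<bullet> p - v \<bullet> p = d" by (simp add: d_def p_def power2_norm_eq_inner inner_diff_left)
  ultimately have "eventually (\<lambda>n. 7 / 8 * d < w (Suc (r n)) \<bullet> p - v \<bullet> p) sequentially"
    by (intro order_tendstoD(1)) (use d in auto)
  then obtain n where n: "7 / 8 * d < w (Suc (r n)) \<bullet> p - v \<bullet> p" "n \<ge> Suc (N1 + N2)"
    using eventually_happens'[OF sequentially_bot eventually_conj[OF _ eventually_ge_at_top]] by blast
  define i where "i = r n"
  have i: "i \<ge> Suc (N1 + N2)" using n(2) seq_suble[OF r(1), of n] by (simp add: i_def)
  have enter: "6 / 8 * d \<le> p \<bullet> (z (Suc i) - v)"
  proof -
    have "7 / 8 * d < p \<bullet> (w (Suc i) - v)"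
      using n(1) by (simp add: i_def inner_diff_right inner_commute)
    moreover have "\<bar>p \<bullet> (z (Suc i) - w (Suc i))\<bar> < d / 8" using N1[of i] i by simp
    ultimately show ?thesis unfolding abs_less_iff inner_diff_right by argo
  qed
  define T where "T k = (\<Sum>l=Suc i..<k. t l)" for k
  have stay: "gap F2 f2 x0 (w k) \<le> - e" if k: "k \<ge> Suc i" "T k \<le> \<tau>" for k
  proof (rule e(2))
    show "w k \<in> C2" using w_in k by simp
    have "(norm (z k - z (Suc i)))\<^sup>2 \<le> D * T k" unfolding T_def using D(2)[of "Suc i" k] i k by simp
    also have "\<dots> \<le> d / 64" using k(2) D(1) \<tau>(2) by (metis less_imp_le mult_left_mono)
    finally have "(norm p)\<^sup>2 * (norm (z k - z (Suc i)))\<^sup>2 \<le> d * (d / 64)"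
      unfolding d_def[symmetric] using d by (intro mult_left_mono) auto
    then have "(norm p * norm (z k - z (Suc i)))\<^sup>2 \<le> (d / 8)\<^sup>2"
      unfolding power_mult_distrib by (simp add: power_divide power2_eq_square[of d])
    then have "norm p * norm (z k - z (Suc i)) \<le> d / 8"
      by (rule power2_le_imp_le) (use d in simp)
    then have "\<bar>p \<bullet> (z k - z (Suc i))\<bar> \<le> d / 8"
      using Cauchy_Schwarz_ineq2[of p "z k - z (Suc i)"] by linarith
    moreover obtain l where "k = Suc l" "l \<ge> N1" using k(1) i by (cases k) auto
    then have "\<bar>p \<bullet> (z k - w k)\<bar> < d / 8" using N1[of l] by simp
    ultimately show "d / 2 \<le> p \<bullet> (w k - v)"
      using enter unfolding abs_less_iff abs_le_iff inner_diff_right by argo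
  qed
  have "\<exists>k. \<tau> < T k"
  proof -
    obtain K where K: "(\<Sum>k=1..i. t k) + \<tau> + 1 \<le> (\<Sum>k=1..K. t k)" "K \<ge> i"
      using eventually_happens'[OF sequentially_bot eventually_conj[OF
          T_lim[unfolded filterlim_at_top, rule_format] eventually_ge_at_top[of i]]] by blast
    have "(\<Sum>k=1..K. t k) = (\<Sum>k=1..i. t k) + (\<Sum>k=Suc i..K. t k)"
      using K(2) sum.ub_add_nat[of 1 i t "K - i"] by simp
    then have "\<tau> < T (Suc K)" using K(1) by (simp add: T_def atLeastLessThanSuc_atLeastAtMost)
    then show ?thesis ..
  qed
  \<comment> \<open>the visit covers all indices below \<open>N\<close>, whose step sizes add up to more than \<open>\<tau>\<close>\<close>
  define N where "N = (LEAST k. \<tau> < T k)"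
  have N: "\<tau> < T N" unfolding N_def using \<open>\<exists>k. \<tau> < T k\<close> by (rule LeastI_ex)
  have before: "T k \<le> \<tau>" if "k < N" for k
    using not_less_Least[of k "\<lambda>k. \<tau> < T k"] that by (simp add: N_def)
  have "e * \<tau> < e * T N" using N e(1) by simp
  also have "\<dots> = (\<Sum>k=Suc i..<N. t k * e)" by (simp add: T_def sum_distrib_left mult.commute)
  also have "\<dots> \<le> (\<Sum>k=Suc i..<N. t k * (- gap F2 f2 x0 (w k)))"
  proof (rule sum_mono, rule mult_left_mono)
    fix k assume k: "k \<in> {Suc i..<N}"
    show "e \<le> - gap F2 f2 x0 (w k)" using stay[of k] before[of k] k by simp
    show "0 \<le> t k" using t_pos[of k] k by simp
  qed
  also have "\<dots> = (\<Sum>k=i..<N - 1. t (Suc k) * (- gap F2 f2 x0 (w (Suc k))))"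
  proof -
    have "N > 0" using N \<tau>(1) by (cases N) (auto simp: T_def)
    then show ?thesis using sum.shift_bounds_Suc_ivl[of "\<lambda>k. t k * (- gap F2 f2 x0 (w k))" i "N - 1"] by simp
  qed
  finally have "e * \<tau> < (\<Sum>k=i..<N - 1. t (Suc k) * (- gap F2 f2 x0 (w (Suc k))))" .
  moreover have "norm (\<Sum>k=i..<N - 1. t (Suc k) * (- gap F2 f2 x0 (w (Suc k)))) < e * \<tau>"
    by (rule N2) (use i in simp)
  ultimately show False unfolding real_norm_def by linarith
qed

section \<open>Weak convergence of the averages\<close>

lemma gap1_bounded_above:
  assumes y: "y \<in> C2"
  obtains K where "0 \<le> K" "\<And>k. k \<ge> 1 \<Longrightarrow> gap F1 f1 y (w k) \<le> K"
proof -
  obtain B where B: "0 \<le> B" "\<And>k. k \<ge> 1 \<Longrightarrow> norm (w k) \<le> B" using iterates_bounded by metis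
  obtain m where m: "\<And>y. y \<in> C1 \<Longrightarrow> norm y \<le> B \<Longrightarrow> m \<le> f1 y"
    using convex_lsc_bounded_below[OF lsc1, of B] by blast
  define A where "A = (norm (F1 0) + L1 * B) * (norm y + B) + f1 y - m"
  have "gap F1 f1 y (w k) \<le> A" if k: "k \<ge> 1" for k
  proof -
    have "F1 (w k) \<bullet> (y - w k) \<le> norm (F1 (w k)) * norm (y - w k)" by (rule norm_cauchy_schwarz)
    also have "\<dots> \<le> (norm (F1 0) + L1 * B) * (norm y + B)"
    proof (rule mult_mono)
      show "norm (F1 (w k)) \<le> norm (F1 0) + L1 * B" by (rule F_bounded[OF lip1 B(2)[OF k]])
      show "norm (y - w k) \<le> norm y + B" using norm_triangle_ineq4[of y "w k"] B(2)[OF k] by linarith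
      show "0 \<le> norm (F1 0) + L1 * B" using L_nonneg(1) B(1) by simp
    qed simp
    moreover have "m \<le> f1 (w k)" using m[OF _ B(2)[OF k]] w_in[OF k] C2_sub by blast
    ultimately show ?thesis unfolding gap_def A_def by linarith
  qed
  then show ?thesis using that[of "max A 0"] by fastforce
qed

abbreviation "W \<equiv> weighted_average t w"

lemma average_in: "K \<ge> 1 \<Longrightarrow> W K \<in> C2"
  using weighted_average_convex(1)[OF convex_lsc_convex_on[OF lsc2] t_pos w_in] .

lemma sum_t_pos: "K \<ge> 1 \<Longrightarrow> 0 < (\<Sum>k=1..K. t k)"
  using t_pos by (intro sum_pos) auto

text \<open>
  The gap is convex in its first argument, so its value at the average is at most the average of
  its values, and monotonicity moves \<open>y\<close> into the first argument, where the energy inequality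
  bounds it.
\<close>

lemma gap_average_le:
  assumes f: "convex_on C f" and F: "monotone_operator F" and w: "\<And>k. k \<ge> 1 \<Longrightarrow> w k \<in> C" and K: "K \<ge> 1"
  shows "gap F f (W K) y \<le> (\<Sum>k=1..K. t k * (- gap F f y (w k))) / (\<Sum>k=1..K. t k)"
proof -
  have "gap F f (W K) y \<le> (\<Sum>k=1..K. t k * gap F f (w k) y) / (\<Sum>k=1..K. t k)"
    by (rule weighted_average_convex(2)[OF convex_on_gap[OF f] t_pos w K])
  also have "\<dots> \<le> (\<Sum>k=1..K. t k * (- gap F f y (w k))) / (\<Sum>k=1..K. t k)"
  proof (rule divide_right_mono, rule sum_mono)
    fix k assume "k \<in> {1..K}"
    then show "t k * gap F f (w k) y \<le> t k * (- gap F f y (w k))"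
      using t_pos[of k] gap_antisymmetric[OF F, of f "w k" y] by (intro mult_left_mono) auto
  qed (use sum_t_pos[OF K] in simp)
  finally show ?thesis .
qed

lemma lower_gap_of_averages:
  assumes y: "y \<in> C2" and e: "e > 0"
  shows "eventually (\<lambda>K. gap F2 f2 (W K) y \<le> e) sequentially"
proof -
  obtain A where A: "0 \<le> A" "\<And>k. k \<ge> 1 \<Longrightarrow> gap F1 f1 y (w k) \<le> A"
    using gap1_bounded_above[OF y] by metis
  have sum_le: "(\<Sum>k=1..K. t k * (- gap F2 f2 y (w k))) + energy y (Suc K)
      \<le> energy y 1 + A * (\<Sum>k=1..K. t k * \<sigma> k)" for K
  proof (induction K)
    case (Suc K)
    have k: "Suc K \<ge> 1" by simp
    have "t (Suc K) * (\<sigma> (Suc K) * gap F1 f1 y (w (Suc K))) \<le> A * (t (Suc K) * \<sigma> (Suc K))"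
      using mult_left_mono[OF A(2)[OF k], of "t (Suc K) * \<sigma> (Suc K)"] t_pos[OF k] \<sigma>_pos[OF k]
      by (simp add: mult_ac)
    moreover have "0 \<le> (norm (z (Suc (Suc K)) - w (Suc K)))\<^sup>2 / 8" "0 \<le> 3 / 8 * (norm (w (Suc K) - z (Suc K)))\<^sup>2"
      by simp_all
    ultimately have "energy y (Suc (Suc K)) \<le> energy y (Suc K)
        + t (Suc K) * gap F2 f2 y (w (Suc K)) + A * (t (Suc K) * \<sigma> (Suc K))"
      using energy_step[OF k y] unfolding distrib_left by linarith
    with Suc show ?case by (simp add: algebra_simps)
  qed simp
  have "(\<lambda>K. energy y 1 / (\<Sum>k=1..K. t k) + A * ((\<Sum>k=1..K. t k * \<sigma> k) / (\<Sum>k=1..K. t k))) \<longlonglongrightarrow> 0 + A * 0"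
    by (intro tendsto_add tendsto_mult tendsto_const average_\<sigma>
        tendsto_divide_0[OF tendsto_const filterlim_at_top_imp_at_infinity[OF T_lim]])
  then have "eventually (\<lambda>K. energy y 1 / (\<Sum>k=1..K. t k)
      + A * ((\<Sum>k=1..K. t k * \<sigma> k) / (\<Sum>k=1..K. t k)) < e) sequentially"
    by (rule order_tendstoD) (use e in simp)
  then show ?thesis using eventually_ge_at_top[of 1]
  proof eventually_elim
    case (elim K)
    have "gap F2 f2 (W K) y \<le> (\<Sum>k=1..K. t k * (- gap F2 f2 y (w k))) / (\<Sum>k=1..K. t k)"
      by (rule gap_average_le[OF convex_lsc_convex_on[OF lsc2] mono2 w_in elim(2)])
    also have "\<dots> \<le> (energy y 1 + A * (\<Sum>k=1..K. t k * \<sigma> k)) / (\<Sum>k=1..K. t k)"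
      using sum_le[of K] energy_nonneg[of y "Suc K"] sum_t_pos[OF elim(2)]
      by (intro divide_right_mono) auto
    also have "\<dots> < e" using elim(1) by (simp add: add_divide_distrib)
    finally show ?case by simp
  qed
qed

text \<open>
  At a point \<open>y\<close> of \<open>S2\<close> the lower-level gap has the right sign, so the energy inequality may be
  divided by \<open>\<sigma> k\<close>. Summation by parts then uses that \<open>1 / \<sigma>\<close> increases and that the energy is
  bounded, and yields a total of order \<open>1 / \<sigma> K\<close>.
\<close>

lemma upper_gap_of_averages:
  assumes y: "y \<in> S2" and e: "e > 0"
  shows "eventually (\<lambda>K. gap F1 f1 (W K) y \<le> e) sequentially"
proof -
  have yC2: "y \<in> C2" using y S2_subset by blast
  obtain B where B: "0 \<le> B" "\<And>k. k \<ge> 1 \<Longrightarrow> norm (z k) \<le> B" "\<And>k. k \<ge> 1 \<Longrightarrow> norm (w k) \<le> B"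
    using iterates_bounded by metis
  define E where "E = (B + norm y)\<^sup>2 / 2 + (2 * B + norm (w 0))\<^sup>2 / 8"
  have energy_le: "energy y k \<le> E" if k: "k \<ge> 1" for k
  proof -
    have "norm (z k - y) \<le> B + norm y"
      using norm_triangle_ineq4[of "z k" y] B(2)[OF k] by linarith
    moreover have "norm (w (k - 1)) \<le> B + norm (w 0)"
    proof (cases "k - 1 \<ge> 1")
      case True
      then show ?thesis using B(3)[OF True] norm_ge_zero[of "w 0"] by linarith
    next
      case False
      then have "k - 1 = 0" by simp
      then show ?thesis using B(1) by simp
    qed
    then have "norm (z k - w (k - 1)) \<le> 2 * B + norm (w 0)"
      using norm_triangle_ineq4[of "z k" "w (k - 1)"] B(2)[OF k] by linarith
    ultimately show ?thesis
      unfolding energy_def E_def by (intro add_mono divide_right_mono power_mono) auto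
  qed
  have step: "t k * (- gap F1 f1 y (w k)) \<le> (energy y k - energy y (Suc k)) / \<sigma> k" if k: "k \<ge> 1" for k
  proof -
    have "t k * gap F2 f2 y (w k) \<le> 0"
      using gap2_nonpos[OF y w_in[OF k]] t_pos[OF k] by (simp add: mult_nonneg_nonpos)
    moreover have "0 \<le> (norm (z (Suc k) - w k))\<^sup>2 / 8" "0 \<le> 3 / 8 * (norm (w k - z k))\<^sup>2" by simp_all
    ultimately have "energy y (Suc k) \<le> energy y k + t k * (\<sigma> k * gap F1 f1 y (w k))"
      using energy_step[OF k yC2] unfolding distrib_left by linarith
    then show ?thesis using \<sigma>_pos[OF k] by (simp add: field_simps)
  qed
  have sum_le: "(\<Sum>k=1..K. t k * (- gap F1 f1 y (w k))) \<le> (E - energy y (Suc K)) / \<sigma> K" if "K \<ge> 1" for K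
    using that
  proof (induction K rule: dec_induct)
    case base
    have "(energy y 1 - energy y (Suc 1)) / \<sigma> 1 \<le> (E - energy y (Suc 1)) / \<sigma> 1"
      using energy_le[of 1] \<sigma>_pos[of 1] by (intro divide_right_mono) auto
    with step[of 1] show ?case by simp
  next
    case (step K)
    note prev = step
    have "(E - energy y (Suc K)) / \<sigma> K \<le> (E - energy y (Suc K)) / \<sigma> (Suc K)"
      using energy_le[of "Suc K"] \<sigma>_decr[of K] \<sigma>_pos[of "Suc K"] prev(1)
      by (intro divide_left_mono) auto
    moreover have "(E - energy y (Suc K)) / \<sigma> (Suc K) + (energy y (Suc K) - energy y (Suc (Suc K))) / \<sigma> (Suc K)
        = (E - energy y (Suc (Suc K))) / \<sigma> (Suc K)"
      by (simp add: add_divide_distrib[symmetric])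
    moreover have "t (Suc K) * (- gap F1 f1 y (w (Suc K))) \<le> (energy y (Suc K) - energy y (Suc (Suc K))) / \<sigma> (Suc K)"
      by (rule \<open>\<And>k. k \<ge> 1 \<Longrightarrow> t k * (- gap F1 f1 y (w k)) \<le> (energy y k - energy y (Suc k)) / \<sigma> k\<close>) simp
    ultimately show ?case using prev(3) by simp
  qed
  have "(\<lambda>K. E / (\<sigma> K * (\<Sum>k=1..K. t k))) \<longlonglongrightarrow> 0"
    by (rule tendsto_divide_0[OF tendsto_const filterlim_at_top_imp_at_infinity[OF \<sigma>T_lim]])
  then have "eventually (\<lambda>K. E / (\<sigma> K * (\<Sum>k=1..K. t k)) < e) sequentially"
    by (rule order_tendstoD) (rule e)
  then show ?thesis using eventually_ge_at_top[of 1]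
  proof eventually_elim
    case (elim K)
    have wC1: "w k \<in> C1" if "k \<ge> 1" for k using w_in[OF that] C2_sub by blast
    have "gap F1 f1 (W K) y \<le> (\<Sum>k=1..K. t k * (- gap F1 f1 y (w k))) / (\<Sum>k=1..K. t k)"
      by (rule gap_average_le[OF convex_lsc_convex_on[OF lsc1] mono1 wC1 elim(2)])
    also have "\<dots> \<le> ((E - energy y (Suc K)) / \<sigma> K) / (\<Sum>k=1..K. t k)"
      using sum_le[OF elim(2)] sum_t_pos[OF elim(2)] by (intro divide_right_mono) auto
    also have "\<dots> \<le> (E / \<sigma> K) / (\<Sum>k=1..K. t k)"
      using energy_nonneg[of y "Suc K"] \<sigma>_pos[OF elim(2)] sum_t_pos[OF elim(2)]
      by (intro divide_right_mono) auto
    also have "\<dots> < e" using elim(1) by simp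
    finally show ?case by simp
  qed
qed

lemma weak_cluster_of_averages_in_S1:
  assumes r: "strict_mono r" "weakly_converges (W \<circ> r) x"
  shows "x \<in> S1"
proof -
  have lim: "eventually (\<lambda>n. P (r n)) sequentially" if "eventually P sequentially" for P
    using eventually_subseq[OF r(1) that] .
  have inC2: "eventually (\<lambda>n. (W \<circ> r) n \<in> C2) sequentially"
    using lim[OF eventually_mono[OF eventually_ge_at_top[of 1] average_in]] by simp
  then have inC1: "eventually (\<lambda>n. (W \<circ> r) n \<in> C1) sequentially"
    by (rule eventually_mono) (use C2_sub in blast)
  have lower: "x \<in> C2 \<and> gap F2 f2 x y \<le> 0" if "y \<in> C2" for y
    by (rule gap_weak_limit[OF lsc2 inC2 r(2)])
       (use lim[OF lower_gap_of_averages[OF that]] in simp)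
  have "x \<in> S2" using lower convex_lsc_nonempty[OF lsc2] unfolding S2_minty by blast
  have upper: "gap F1 f1 x y \<le> 0" if "y \<in> S2" for y
  proof -
    have "x \<in> C1 \<and> gap F1 f1 x y \<le> 0"
      by (rule gap_weak_limit[OF lsc1 inC1 r(2)])
         (use lim[OF upper_gap_of_averages[OF that]] in simp)
    then show ?thesis by simp
  qed
  with \<open>x \<in> S2\<close> show ?thesis unfolding S1_minty by blast
qed

text \<open>
  The distances to two points \<open>x\<close> and \<open>x'\<close> of \<open>S1\<close> converge, and the difference of their squares is
  \<open>z \<bullet> (x - x')\<close> up to a factor and a constant. Convergence passes from \<open>z\<close> to \<open>w\<close> and to averages.
\<close>

lemma averages_converge_along_S1:
  assumes "x \<in> S1" "x' \<in> S1"
  shows "convergent (\<lambda>K. W K \<bullet> (x - x'))"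
proof -
  obtain a b where ab: "(\<lambda>n. (norm (z (Suc n) - x))\<^sup>2) \<longlonglongrightarrow> a" "(\<lambda>n. (norm (z (Suc n) - x'))\<^sup>2) \<longlonglongrightarrow> b"
    using convergent_distance assms by (meson convergent_def)
  define l where "l = (b - a + x \<bullet> x - x' \<bullet> x') / 2"
  have "(\<lambda>n. ((norm (z (Suc n) - x'))\<^sup>2 - (norm (z (Suc n) - x))\<^sup>2 + x \<bullet> x - x' \<bullet> x') / 2
      - (z (Suc n) - w (Suc n)) \<bullet> (x - x')) \<longlonglongrightarrow> l - 0 \<bullet> (x - x')"
    unfolding l_def by (intro tendsto_diff tendsto_divide tendsto_add tendsto_const ab
        tendsto_inner[OF steps_vanish(1) tendsto_const]) simp
  moreover have "((norm (z (Suc n) - x'))\<^sup>2 - (norm (z (Suc n) - x))\<^sup>2 + x \<bullet> x - x' \<bullet> x') / 2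
      - (z (Suc n) - w (Suc n)) \<bullet> (x - x') = w (Suc n) \<bullet> (x - x')" for n
    unfolding power2_norm_eq_inner
    by (simp add: inner_diff_left inner_diff_right inner_commute field_simps)
  ultimately have "(\<lambda>n. w (Suc n) \<bullet> (x - x')) \<longlonglongrightarrow> l" by simp
  then have lim: "(\<lambda>n. w n \<bullet> (x - x')) \<longlonglongrightarrow> l"
    by (simp only: filterlim_sequentially_Suc[of "\<lambda>n. w n \<bullet> (x - x')"])
  have "weighted_average t (\<lambda>n. w n \<bullet> (x - x')) \<longlonglongrightarrow> l"
    by (rule weighted_average_tendsto[OF _ T_lim lim]) (rule t_pos)
  then show ?thesis unfolding inner_weighted_average convergent_def by blast
qed

theorem averages_converge_weakly:
  assumes "separable_space (euclidean :: 'a topology)"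
  shows "\<exists>x\<in>S1. weakly_converges W x"
proof -
  obtain B where B: "0 \<le> B" "\<And>k. k \<ge> 1 \<Longrightarrow> norm (w k) \<le> B" using iterates_bounded by metis
  show ?thesis
    by (rule opial[OF assms weighted_average_norm_le[OF t_pos B(2) B(1)]
          weak_cluster_of_averages_in_S1 averages_converge_along_S1])
qed

end

section \<open>Translation from extended-real functions\<close>

lemma subdifferential_iff:
  assumes g: "g \<in> Gamma0"
  shows "p \<in> subdifferential g x \<longleftrightarrow> x \<in> eff_dom g \<and>
    (\<forall>y\<in>eff_dom g. real_of_ereal (g x) + p \<bullet> (y - x) \<le> real_of_ereal (g y))"
proof -
  note fin = convex_lsc_of_Gamma0(2)[OF g] and inf = convex_lsc_of_Gamma0(3)[OF g]
  have finite_iff: "g x + ereal (p \<bullet> (y - x)) \<le> g y \<longleftrightarrow>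
      real_of_ereal (g x) + p \<bullet> (y - x) \<le> real_of_ereal (g y)"
    if "x \<in> eff_dom g" "y \<in> eff_dom g" for y
    using fin[OF that(1)] fin[OF that(2)] by (metis ereal_less_eq(3) plus_ereal.simps(1))
  show ?thesis
  proof
    assume p: "p \<in> subdifferential g x"
    then have le: "g x + ereal (p \<bullet> (y - x)) \<le> g y" for y by (simp add: subdifferential_def)
    obtain y where y: "y \<in> eff_dom g" using g by (auto simp: Gamma0_def)
    have "x \<in> eff_dom g"
    proof (rule ccontr)
      assume "x \<notin> eff_dom g"
      then show False using le[of y] inf[of x] fin[OF y] by (metis PInfty_neq_ereal(1) ereal_infty_less_eq(1) plus_ereal.simps(2))
    qed
    with le finite_iff show "x \<in> eff_dom g \<and>
        (\<forall>y\<in>eff_dom g. real_of_ereal (g x) + p \<bullet> (y - x) \<le> real_of_ereal (g y))" by blast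
  next
    assume r: "x \<in> eff_dom g \<and>
        (\<forall>y\<in>eff_dom g. real_of_ereal (g x) + p \<bullet> (y - x) \<le> real_of_ereal (g y))"
    have "g x + ereal (p \<bullet> (y - x)) \<le> g y" for y
      using r finite_iff[of y] inf[of y] by (cases "y \<in> eff_dom g") auto
    then show "p \<in> subdifferential g x" by (simp add: subdifferential_def)
  qed
qed

lemma zer_add_subdifferential:
  assumes g: "g \<in> Gamma0"
  shows "zer (op_add (single F) (subdifferential g)) = vi_solutions F (\<lambda>x. real_of_ereal (g x)) (eff_dom g)"
proof -
  have "x \<in> zer (op_add (single F) (subdifferential g)) \<longleftrightarrow> - F x \<in> subdifferential g x" for x
    by (auto simp: zer_def op_add_def single_def eq_neg_iff_add_eq_0 add.commute)
       (metis add.commute add_eq_0_iff)+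
  then show ?thesis
    by (auto simp: subdifferential_iff[OF g] vi_solutions_def gap_def algebra_simps)
qed

lemma hierarchical_solutions_eq:
  assumes g: "g \<in> Gamma0" and S: "S \<subseteq> eff_dom g"
  shows "hierarchical_solutions F g S = vi_solutions F (\<lambda>x. real_of_ereal (g x)) S"
proof -
  note fin = convex_lsc_of_Gamma0(2)[OF g]
  have iff: "0 \<le> ereal (F x \<bullet> (y - x)) + g y - g x \<longleftrightarrow> 0 \<le> gap F (\<lambda>x. real_of_ereal (g x)) y x"
    if xy: "x \<in> S" "y \<in> S" for x y
  proof -
    have "g x = ereal (real_of_ereal (g x))" "g y = ereal (real_of_ereal (g y))"
      using S xy by (auto intro: fin)
    then obtain a b where "g x = ereal a" "g y = ereal b" by blast
    then show ?thesis by (simp add: gap_def)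
  qed
  show ?thesis
    unfolding hierarchical_solutions_def vi_solutions_def
    by (intro Collect_cong conj_cong refl ball_cong) (use iff in simp)
qed

lemma hierarchical_optimality:
  assumes g: "g \<in> Gamma0" and F: "monotone_operator F"
    and x: "x \<in> zer (op_add (op_add (single F) (subdifferential g)) (normal_cone S))"
  shows "\<exists>p\<in>normal_cone S x. \<forall>y\<in>eff_dom g. gap F (\<lambda>x. real_of_ereal (g x)) x y \<le> p \<bullet> (y - x)"
proof -
  obtain q p where q: "q \<in> subdifferential g x" and p: "p \<in> normal_cone S x" and sum: "0 = (F x + q) + p"
    using x by (auto simp: zer_def op_add_def single_def)
  have q_eq: "q = - F x - p" using sum by (simp add: algebra_simps eq_neg_iff_add_eq_0)
  have "gap F (\<lambda>x. real_of_ereal (g x)) x y \<le> p \<bullet> (y - x)" if y: "y \<in> eff_dom g" for y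
  proof -
    have "real_of_ereal (g x) + q \<bullet> (y - x) \<le> real_of_ereal (g y)"
      using q y by (simp add: subdifferential_iff[OF g])
    moreover have "gap F (\<lambda>x. real_of_ereal (g x)) x y \<le> - gap F (\<lambda>x. real_of_ereal (g x)) y x"
      by (rule gap_antisymmetric[OF F])
    ultimately show ?thesis by (simp add: gap_def q_eq inner_diff_left)
  qed
  with p show ?thesis by blast
qed

text \<open>
  Each summand is non-negative because \<open>H_fun F g x x = 0\<close>, so the finite total makes every excess
  finite and the real series convergent.
\<close>

lemma excess_bounds:
  assumes g: "g \<in> Gamma0" and S: "S \<subseteq> eff_dom g" and p: "p \<in> normal_cone S v"
    and t: "\<And>k. k \<ge> 1 \<Longrightarrow> t k > 0" and \<sigma>: "\<And>k. k \<ge> 1 \<Longrightarrow> \<sigma> k > 0"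
    and fin: "(\<Sum>k. ereal (t (Suc k)) *
              ((SUP x\<in>S. phi_fun F g x (\<sigma> (Suc k) *\<^sub>R p))
                - support_fun S (\<sigma> (Suc k) *\<^sub>R p))) < \<infinity>"
  shows "\<exists>\<delta>. (\<forall>k\<ge>1. 0 \<le> \<delta> k) \<and> summable (\<lambda>k. t (Suc k) * \<delta> (Suc k)) \<and>
          (\<forall>k\<ge>1. \<forall>x\<in>S. \<forall>y\<in>eff_dom g.
            gap F (\<lambda>x. real_of_ereal (g x)) x y + \<sigma> k * (p \<bullet> (y - v)) \<le> \<delta> k)"
proof -
  note gfin = convex_lsc_of_Gamma0(2)[OF g]
  define a where "a k = (SUP x\<in>S. phi_fun F g x (\<sigma> k *\<^sub>R p))" for k
  have v: "v \<in> S" and pv: "\<And>y. y \<in> S \<Longrightarrow> p \<bullet> (y - v) \<le> 0" using p by (auto simp: normal_cone_def)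
  have support: "support_fun S (\<sigma> k *\<^sub>R p) = ereal (\<sigma> k * (p \<bullet> v))" if k: "k \<ge> 1" for k
    unfolding support_fun_def
  proof (rule antisym)
    show "(SUP x\<in>S. ereal ((\<sigma> k *\<^sub>R p) \<bullet> x)) \<le> ereal (\<sigma> k * (p \<bullet> v))"
    proof (rule SUP_least)
      fix x assume "x \<in> S"
      then have "p \<bullet> x \<le> p \<bullet> v" using pv[of x] by (simp add: inner_diff_right)
      then show "ereal ((\<sigma> k *\<^sub>R p) \<bullet> x) \<le> ereal (\<sigma> k * (p \<bullet> v))" using \<sigma>[OF k] by simp
    qed
    show "ereal (\<sigma> k * (p \<bullet> v)) \<le> (SUP x\<in>S. ereal ((\<sigma> k *\<^sub>R p) \<bullet> x))"
      by (rule SUP_upper2[OF v]) simp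
  qed
  have lower: "ereal (gap F (\<lambda>x. real_of_ereal (g x)) x y + \<sigma> k * (p \<bullet> y)) \<le> a k"
    if "x \<in> S" "y \<in> eff_dom g" for x y k
    unfolding a_def
  proof (rule SUP_upper2[OF that(1)])
    have "g x = ereal (real_of_ereal (g x))" "g y = ereal (real_of_ereal (g y))"
      using S that by (auto intro: gfin)
    then obtain b c where "g x = ereal b" "g y = ereal c" by blast
    then have "ereal (gap F (\<lambda>x. real_of_ereal (g x)) x y + \<sigma> k * (p \<bullet> y))
        = H_fun F g x y + ereal (y \<bullet> (\<sigma> k *\<^sub>R p))"
      by (simp add: gap_def H_fun_def inner_commute)
    also have "\<dots> \<le> phi_fun F g x (\<sigma> k *\<^sub>R p)"
      unfolding phi_fun_def by (rule SUP_upper[OF that(2)])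
    finally show "ereal (gap F (\<lambda>x. real_of_ereal (g x)) x y + \<sigma> k * (p \<bullet> y))
        \<le> phi_fun F g x (\<sigma> k *\<^sub>R p)" .
  qed
  define b where "b k = ereal (t (Suc k)) * (a (Suc k) - ereal (\<sigma> (Suc k) * (p \<bullet> v)))" for k
  have b_fin: "suminf b \<noteq> \<infinity>"
    using fin support unfolding b_def a_def by simp
  have excess: "0 \<le> a k - ereal (\<sigma> k * (p \<bullet> v))" for k
    using lower[OF v, of v k] v S by (cases "a k") (auto simp: gap_def)
  then have b_nonneg: "0 \<le> b k" for k
    unfolding b_def using t[of "Suc k"] by simp
  have a_real: "\<exists>r. a (Suc k) = ereal r" for k
  proof -
    have "b k \<noteq> \<infinity>" by (rule suminf_PInfty[OF b_nonneg b_fin])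
    then have "a (Suc k) \<noteq> \<infinity>" using t[of "Suc k"] by (auto simp: b_def)
    moreover have "a (Suc k) \<noteq> - \<infinity>" using excess[of "Suc k"] by auto
    ultimately show ?thesis by (cases "a (Suc k)") auto
  qed
  define \<delta> where "\<delta> k = real_of_ereal (a k) - \<sigma> k * (p \<bullet> v)" for k
  have \<delta>: "a (Suc k) = ereal (\<delta> (Suc k) + \<sigma> (Suc k) * (p \<bullet> v))" for k
    using a_real[of k] by (auto simp: \<delta>_def)
  have "b k = ereal (t (Suc k) * \<delta> (Suc k))" for k
    by (simp add: b_def \<delta>)
  then have "summable (\<lambda>k. t (Suc k) * \<delta> (Suc k))"
    using summable_real_of_ereal[OF b_nonneg b_fin] by simp
  moreover have "0 \<le> \<delta> k" if "k \<ge> 1" for k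
    using that excess[of k] \<delta>[of "k - 1"] by simp
  moreover have "gap F (\<lambda>x. real_of_ereal (g x)) x y + \<sigma> k * (p \<bullet> (y - v)) \<le> \<delta> k"
    if "k \<ge> 1" "x \<in> S" "y \<in> eff_dom g" for k x y
    using lower[OF that(2,3), of k] \<delta>[of "k - 1"] that(1) by (simp add: inner_diff_right algebra_simps)
  ultimately show ?thesis by blast
qed

lemma extragradient_prox:
  fixes g1 g2 :: "'a::{real_inner, complete_space} \<Rightarrow> ereal"  and u :: 'a
  assumes g: "g1 \<in> Gamma0" "g2 \<in> Gamma0" "eff_dom g2 \<subseteq> eff_dom g1" and pos: "s > 0" "c > 0"
  defines "P \<equiv> prox (\<lambda>x. ereal s * (g2 x + ereal c * g1 x)) u"
  shows "P \<in> eff_dom g2"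
    and "\<And>y. y \<in> eff_dom g2 \<Longrightarrow> (u - P) \<bullet> (y - P) \<le>
      s * ((real_of_ereal (g2 y) + c * real_of_ereal (g1 y)) - (real_of_ereal (g2 P) + c * real_of_ereal (g1 P)))"
proof -
  let ?G = "\<lambda>x. ereal s * (g2 x + ereal c * g1 x)"
  let ?f = "\<lambda>x. real_of_ereal (g2 x) + c * real_of_ereal (g1 x)"
  have f: "convex_lsc (eff_dom g2) ?f"
    by (rule convex_lsc_add_scaled[OF convex_lsc_of_Gamma0(1)[OF g(2)] convex_lsc_of_Gamma0(1)[OF g(1)] g(3) pos(2)])
  have sf: "convex_lsc (eff_dom g2) (\<lambda>x. s * ?f x)"
    by (rule convex_lsc_scaled[OF f pos(1)])
  have inside: "?G x = ereal (s * ?f x)" if x: "x \<in> eff_dom g2" for x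
  proof -
    obtain a b where "g2 x = ereal a" "g1 x = ereal b"
      using convex_lsc_of_Gamma0(2)[OF g(2) x] convex_lsc_of_Gamma0(2)[OF g(1) subsetD[OF g(3) x]] by metis
    then show ?thesis by simp
  qed
  have outside: "?G x = \<infinity>" if "x \<notin> eff_dom g2" for x
  proof -
    have "g2 x = \<infinity>" "g1 x \<noteq> - \<infinity>" using convex_lsc_of_Gamma0(3)[OF g(2) that] g(1) by (auto simp: Gamma0_def)
    then show ?thesis using pos by (cases "g1 x") auto
  qed
  note prox = prox_real[OF sf, of ?G, OF inside outside]
  show "P \<in> eff_dom g2" unfolding P_def by (rule prox(1))
  show "(u - P) \<bullet> (y - P) \<le> s * (?f y - ?f P)" if "y \<in> eff_dom g2" for y
    using prox(2)[OF _ _ that, of u] unfolding P_def right_diff_distrib by linarith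
qed

theorem theorem3p3:
  fixes F1 F2 :: "'a::{real_inner, complete_space} \<Rightarrow> 'a"
    and g1 g2 :: "'a \<Rightarrow> ereal"
    and L1 L2 :: real
    and S1 S2 :: "'a set"
    and t \<sigma> :: "nat \<Rightarrow> real"
    and z w :: "nat \<Rightarrow> 'a"
  assumes "separable_space (euclidean :: 'a topology)"
    and "monotone_operator F1" and "L1-lipschitz_on UNIV F1"
    and "monotone_operator F2" and "L2-lipschitz_on UNIV F2"
    and "g1 \<in> Gamma0" and "g2 \<in> Gamma0"
    and "eff_dom g1 \<inter> eff_dom g2 \<noteq> {}"
    and "S2 = zer (op_add (single F2) (subdifferential g2))"
    and "S2 \<noteq> {}"
    and "S1 = hierarchical_solutions F1 g1 S2"
    and "S1 = zer (op_add (op_add (single F1) (subdifferential g1)) (normal_cone S2))"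
    and "S1 \<noteq> {}"
    and "\<forall>k\<ge>1. t k > 0"
    and "\<forall>k\<ge>1. \<sigma> k > 0"
    and "\<forall>k\<ge>1. \<sigma> (k + 1) \<le> \<sigma> k"
    and "\<sigma> \<longlonglongrightarrow> 0"
    and "filterlim (\<lambda>K. \<Sum>k=1..K. t k) at_top sequentially"
    and "filterlim (\<lambda>K. \<sigma> K * (\<Sum>k=1..K. t k)) at_top sequentially"
    and "(\<lambda>K. (\<Sum>k=1..K. t k * \<sigma> k) / (\<Sum>k=1..K. t k)) \<longlonglongrightarrow> 0"
    and "\<forall>p\<in>op_range (normal_cone S2).
           (\<Sum>k. ereal (t (Suc k)) *
              ((SUP x\<in>S2. phi_fun F2 g2 x (\<sigma> (Suc k) *\<^sub>R p))
                - support_fun S2 (\<sigma> (Suc k) *\<^sub>R p))) < \<infinity>"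
    and "eff_dom g2 \<subseteq> eff_dom g1"
    and "optimistic_extragradient F1 F2 g1 g2 t \<sigma> z w"
    and "\<forall>k\<ge>1. 16 * (t k)\<^sup>2 * (L2 + \<sigma> k * L1)\<^sup>2 \<le> 1"
  shows "(\<forall>x. weak_accumulation_point (\<lambda>k. w (Suc k)) x \<longrightarrow> x \<in> S2)
    \<and> (closed (eff_dom g1 \<inter> eff_dom g2)
       \<and> (\<forall>A B. compact A \<and> compact B
             \<and> A \<subseteq> eff_dom g1 \<inter> eff_dom g2 \<and> B \<subseteq> eff_dom g1 \<inter> eff_dom g2
             \<longrightarrow> (SUP (x, y)\<in>A \<times> B. \<bar>g1 x - g1 y\<bar>) < \<infinity>)
       \<longrightarrow> (\<exists>x\<in>S1. weakly_converges
             (\<lambda>K. (1 / (\<Sum>k=1..K. t k)) *\<^sub>R (\<Sum>k=1..K. t k *\<^sub>R w k)) x))"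
proof -
  note sep = assms(1) and mono1 = assms(2) and lip1 = assms(3) and mono2 = assms(4) and lip2 = assms(5)
    and g1 = assms(6) and g2 = assms(7) and dom = assms(22) and iteration = assms(23)
  have t: "t k > 0" and \<sigma>: "\<sigma> k > 0" if "k \<ge> 1" for k
    using assms(14,15) that by blast+
  have S2: "S2 = vi_solutions F2 (\<lambda>x. real_of_ereal (g2 x)) (eff_dom g2)"
    unfolding assms(9) by (rule zer_add_subdifferential[OF g2])
  have S2_dom: "S2 \<subseteq> eff_dom g2" unfolding S2 vi_solutions_def by blast
  have S1: "S1 = vi_solutions F1 (\<lambda>x. real_of_ereal (g1 x)) S2"
    unfolding assms(11) by (rule hierarchical_solutions_eq[OF g1 order_trans[OF S2_dom dom]])
  have w_eq: "w k = prox (\<lambda>x. ereal (t k) * (g2 x + ereal (\<sigma> k) * g1 x))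
        (z k - t k *\<^sub>R (F2 (w (k - 1)) + \<sigma> k *\<^sub>R F1 (w (k - 1))))"
    and z_eq: "z (Suc k) = prox (\<lambda>x. ereal (t k) * (g2 x + ereal (\<sigma> k) * g1 x))
        (z k - t k *\<^sub>R (F2 (w k) + \<sigma> k *\<^sub>R F1 (w k)))" if "k \<ge> 1" for k
    using iteration that unfolding optimistic_extragradient_def Let_def by simp_all
  interpret hierarchical_extragradient F1 F2 "\<lambda>x. real_of_ereal (g1 x)" "\<lambda>x. real_of_ereal (g2 x)"
    "eff_dom g1" "eff_dom g2" L1 L2 t \<sigma> z w S1 S2
  proof
    show "convex_lsc (eff_dom g1) (\<lambda>x. real_of_ereal (g1 x))"
      "convex_lsc (eff_dom g2) (\<lambda>x. real_of_ereal (g2 x))"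
      by (rule convex_lsc_of_Gamma0(1)[OF g1] convex_lsc_of_Gamma0(1)[OF g2])+
    show "4 * t k * (L2 + \<sigma> k * L1) \<le> 1" if "k \<ge> 1" for k
    proof -
      have "(4 * t k * (L2 + \<sigma> k * L1))\<^sup>2 \<le> 1\<^sup>2"
        using assms(24) that by (simp add: power_mult_distrib)
      then show ?thesis by (rule power2_le_imp_le) simp
    qed
    show "z 1 = w 0" using iteration unfolding optimistic_extragradient_def by blast
    fix k :: nat assume k: "k \<ge> 1"
    show "w k \<in> eff_dom g2" unfolding w_eq[OF k] by (rule extragradient_prox(1)[OF g1 g2 dom t[OF k] \<sigma>[OF k]])
    show "z (Suc k) \<in> eff_dom g2" unfolding z_eq[OF k] by (rule extragradient_prox(1)[OF g1 g2 dom t[OF k] \<sigma>[OF k]])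
    fix y assume y: "y \<in> eff_dom g2"
    note ineq = extragradient_prox(2)[OF g1 g2 dom t[OF k] \<sigma>[OF k] y]
    show "(z k - t k *\<^sub>R (F2 (w (k - 1)) + \<sigma> k *\<^sub>R F1 (w (k - 1))) - w k) \<bullet> (y - w k)
        \<le> t k * (real_of_ereal (g2 y) + \<sigma> k * real_of_ereal (g1 y)
            - (real_of_ereal (g2 (w k)) + \<sigma> k * real_of_ereal (g1 (w k))))"
      using ineq[of "z k - t k *\<^sub>R (F2 (w (k - 1)) + \<sigma> k *\<^sub>R F1 (w (k - 1)))"] unfolding w_eq[OF k, symmetric] .
    show "(z k - t k *\<^sub>R (F2 (w k) + \<sigma> k *\<^sub>R F1 (w k)) - z (Suc k)) \<bullet> (y - z (Suc k))
        \<le> t k * (real_of_ereal (g2 y) + \<sigma> k * real_of_ereal (g1 y)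
            - (real_of_ereal (g2 (z (Suc k))) + \<sigma> k * real_of_ereal (g1 (z (Suc k)))))"
      using ineq[of "z k - t k *\<^sub>R (F2 (w k) + \<sigma> k *\<^sub>R F1 (w k))"] unfolding z_eq[OF k, symmetric] .
  next
    show "\<exists>p\<in>normal_cone S2 x. \<forall>y\<in>eff_dom g1. gap F1 (\<lambda>x. real_of_ereal (g1 x)) x y \<le> p \<bullet> (y - x)"
      if "x \<in> S1" for x
      using hierarchical_optimality[OF g1 mono1] that assms(12) by blast
  next
    show "\<exists>\<delta>. (\<forall>k\<ge>1. 0 \<le> \<delta> k) \<and> summable (\<lambda>k. t (Suc k) * \<delta> (Suc k)) \<and>
          (\<forall>k\<ge>1. \<forall>x\<in>S2. \<forall>y\<in>eff_dom g2.
            gap F2 (\<lambda>x. real_of_ereal (g2 x)) x y + \<sigma> k * (p \<bullet> (y - v)) \<le> \<delta> k)"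
      if p: "p \<in> normal_cone S2 v" for p v
    proof (rule excess_bounds[OF g2 S2_dom p t \<sigma>])
      have "p \<in> op_range (normal_cone S2)" using p unfolding op_range_def by blast
      with assms(21) show "(\<Sum>k. ereal (t (Suc k)) *
              ((SUP x\<in>S2. phi_fun F2 g2 x (\<sigma> (Suc k) *\<^sub>R p))
                - support_fun S2 (\<sigma> (Suc k) *\<^sub>R p))) < \<infinity>" by blast
    qed
  next
    show "\<sigma> (Suc k) \<le> \<sigma> k" if "k \<ge> 1" for k
      using assms(16) that by simp
  qed (fact mono1 lip1 mono2 lip2 dom t \<sigma> S2 S1 assms(13) assms(18) assms(19) assms(20))+
  have "\<exists>x\<in>S1. weakly_converges
      (\<lambda>K. (1 / (\<Sum>k=1..K. t k)) *\<^sub>R (\<Sum>k=1..K. t k *\<^sub>R w k)) x"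
    using averages_converge_weakly[OF sep] unfolding weighted_average_def .
  with weak_accumulation_points_in_S2 show ?thesis by blast
qed

end
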